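(* Consider the system of two second-order ODEs, linear in the first derivatives, $$y''+C^2_2y'+C^2_3z'+D^2=0,$$ $$z''+C^3_2y'+C^3_3z'+D^3=0,$$ where $'$ denotes differentiation with respect to $x$, the coefficients $C^a_b$ are independent of $y$ and $z$ (functions of $x$ only), and $D^2,D^3$ are functions of $(x,y,z)$. This system is linearizable by point transformations to the simplest system of two equations if and only if the $C^a_b$ and $D^a$ satisfy the three conditions $$\tfrac12C^3_{2x}+\tfrac14C^3_3C^3_2+\tfrac14C^2_2C^3_2=D^3_y,$$ $$\tfrac12C^2_{3x}+\tfrac14C^2_3C^3_3+\tfrac14C^2_3C^2_2=D^2_z,$$ $$\tfrac12C^3_{3x}-\tfrac12C^2_{2x}+\tfrac14C^3_3C^3_3-\tfrac14C^2_2C^2_2=D^3_z-D^2_y.$$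
   Context: The superscripts and subscripts $2,3$ on $C$ and $D$ are index labels ($2$ refers to $y$, $3$ to $z$), not powers. A trailing subscript $x$, $y$ or $z$ denotes the partial derivative with respect to that variable, e.g. $C^3_{2x}=\partial C^3_2/\partial x$, $D^3_y=\partial D^3/\partial y$. All functions are smooth and all statements are local. A point transformation is a locally invertible change of the independent and dependent variables $u=u(x,y,z)$, $v=v(x,y,z)$, $w=w(x,y,z)$, with $u$ the new independent variable and $v,w$ the new dependent variables. The simplest system of two second-order ODEs is the free particle system $d^2v/du^2=0$, $d^2w/du^2=0$ (whose Lie point symmetry algebra is $sl(4,\mathbb{R})$). A system is linearizable by point transformations to the simplest system if some point transformation maps it to the free particle system. *)

theory Defs
  imports "HOL-Analysis.Analysis"
begin

section \<open>Smooth maps\<close>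

primrec Ck_on :: "nat \<Rightarrow> 'a::real_normed_vector set \<Rightarrow> ('a \<Rightarrow> 'b::real_normed_vector) \<Rightarrow> bool" where
  "Ck_on 0 S f \<longleftrightarrow> continuous_on S f"
| "Ck_on (Suc k) S f \<longleftrightarrow>
     (\<forall>x\<in>S. f differentiable (at x)) \<and> (\<forall>h. Ck_on k S (\<lambda>x. frechet_derivative f (at x) h))"

text \<open>Only meaningful for open \<open>S\<close>, since \<open>at x\<close> refers to full neighbourhoods.\<close>

definition smooth_on :: "'a::real_normed_vector set \<Rightarrow> ('a \<Rightarrow> 'b::real_normed_vector) \<Rightarrow> bool" where
  "smooth_on S f \<longleftrightarrow> (\<forall>k. Ck_on k S f)"

text \<open>Functions of \<open>(x, y, z)\<close> are functions on \<open>real \<times> real \<times> real\<close>.\<close>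

definition partial_y :: "(real \<times> real \<times> real \<Rightarrow> real) \<Rightarrow> real \<times> real \<times> real \<Rightarrow> real" where
  "partial_y f = (\<lambda>(x, y, z). deriv (\<lambda>t. f (x, t, z)) y)"

definition partial_z :: "(real \<times> real \<times> real \<Rightarrow> real) \<Rightarrow> real \<times> real \<times> real \<Rightarrow> real" where
  "partial_z f = (\<lambda>(x, y, z). deriv (\<lambda>t. f (x, y, t)) z)"

section \<open>Systems of two second-order ODEs and their solutions\<close>

text \<open>A system is given by the relation it imposes on \<open>(x, y, z, y', z', y'', z'')\<close>.\<close>

type_synonym ode_system = "real \<Rightarrow> real \<Rightarrow> real \<Rightarrow> real \<Rightarrow> real \<Rightarrow> real \<Rightarrow> real \<Rightarrow> bool"

definition twice_differentiable_on :: "real set \<Rightarrow> (real \<Rightarrow> real) \<Rightarrow> bool" where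
  "twice_differentiable_on I f \<longleftrightarrow>
     (\<forall>t\<in>I. f differentiable (at t)) \<and> (\<forall>t\<in>I. deriv f differentiable (at t))"

definition solves :: "ode_system \<Rightarrow> real set \<Rightarrow> (real \<Rightarrow> real) \<Rightarrow> (real \<Rightarrow> real) \<Rightarrow> bool" where
  "solves P I y z \<longleftrightarrow> twice_differentiable_on I y \<and> twice_differentiable_on I z \<and>
     (\<forall>t\<in>I. P t (y t) (z t) (deriv y t) (deriv z t) (deriv (deriv y) t) (deriv (deriv z) t))"

definition free_particle :: ode_system where
  "free_particle u v w v1 w1 v2 w2 \<longleftrightarrow> v2 = 0 \<and> w2 = 0"

section \<open>Point transformations\<close>

text \<open>A map \<open>\<phi> (x, y, z) = (u, v, w)\<close> that is a diffeomorphism of the open set \<open>V\<close> onto an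
  open set.\<close>

definition point_transformation ::
    "(real \<times> real \<times> real) set \<Rightarrow> (real \<times> real \<times> real \<Rightarrow> real \<times> real \<times> real) \<Rightarrow> bool" where
  "point_transformation V \<phi> \<longleftrightarrow> open V \<and> smooth_on V \<phi> \<and> open (\<phi> ` V) \<and>
     (\<exists>\<psi>. smooth_on (\<phi> ` V) \<psi> \<and> (\<forall>p\<in>V. \<psi> (\<phi> p) = p))"

text \<open>The image of a graph \<open>(t, y t, z t)\<close> under \<open>\<phi>\<close> is locally a graph over the new
  independent variable \<open>u\<close> only where the total derivative \<open>du/dt\<close> along it does not vanish.
  On such curves, \<open>\<phi>\<close> has to match the solutions of \<open>P\<close> with those of \<open>Q\<close>: the curve solves \<open>P\<close>
  iff its image is the graph of a solution \<open>v = \<eta> u\<close>, \<open>w = \<zeta> u\<close> of \<open>Q\<close>.\<close>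

definition maps_system ::
    "(real \<times> real \<times> real \<Rightarrow> real \<times> real \<times> real) \<Rightarrow> (real \<times> real \<times> real) set \<Rightarrow>
      ode_system \<Rightarrow> ode_system \<Rightarrow> bool" where
  "maps_system \<phi> V P Q \<longleftrightarrow>
     (\<forall>I y z. let u = (\<lambda>t. fst (\<phi> (t, y t, z t))) in
        open I \<and> is_interval I \<and> twice_differentiable_on I y \<and> twice_differentiable_on I z \<and>
        (\<forall>t\<in>I. (t, y t, z t) \<in> V) \<and> (\<forall>t\<in>I. deriv u t \<noteq> 0) \<longrightarrow>
        (solves P I y z \<longleftrightarrow>
          (\<exists>\<eta> \<zeta>. (\<forall>t\<in>I. \<phi> (t, y t, z t) = (u t, \<eta> (u t), \<zeta> (u t))) \<and>
                 solves Q (u ` I) \<eta> \<zeta>)))"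

text \<open>Linearizability of a system on \<open>U\<close> is understood locally, near each point of \<open>U\<close>.\<close>

definition linearizable :: "(real \<times> real \<times> real) set \<Rightarrow> ode_system \<Rightarrow> bool" where
  "linearizable U P \<longleftrightarrow>
     (\<forall>p\<in>U. \<exists>V \<phi>. p \<in> V \<and> V \<subseteq> U \<and> point_transformation V \<phi> \<and> maps_system \<phi> V P free_particle)"

section \<open>Systems linear in the first derivatives\<close>

text \<open>\<open>Cab\<close> is the coefficient with upper index \<open>a\<close> and lower index \<open>b\<close>; likewise \<open>Da\<close>.\<close>

definition linear_in_first_derivatives ::
    "(real \<Rightarrow> real) \<Rightarrow> (real \<Rightarrow> real) \<Rightarrow> (real \<Rightarrow> real) \<Rightarrow> (real \<Rightarrow> real) \<Rightarrow>
      (real \<times> real \<times> real \<Rightarrow> real) \<Rightarrow> (real \<times> real \<times> real \<Rightarrow> real) \<Rightarrow> ode_system" where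
  "linear_in_first_derivatives C22 C23 C32 C33 D2 D3 x y z y1 z1 y2 z2 \<longleftrightarrow>
     y2 + C22 x * y1 + C23 x * z1 + D2 (x, y, z) = 0 \<and>
     z2 + C32 x * y1 + C33 x * z1 + D3 (x, y, z) = 0"

end

theory Submission
  imports Defs
begin

text \<open>Let \<open>Y = (y, z)\<close> and write the system as \<open>Y'' + C Y' + D = 0\<close>.

  Necessity: the preimages of straight lines under \<open>\<phi>\<close> solve the system. Hence, for every direction
  \<open>(1, p, q)\<close>, the second derivative of \<open>\<phi>\<close> along the solution is parallel to its first derivative. This
  is a cubic polynomial identity in \<open>p, q\<close>; its coefficients express all second derivatives of \<open>\<phi>\<close>
  through the first ones, with coefficients in \<open>C, D\<close> and three unknown functions. The compatibility
  conditions \<open>(\<phi>\<^sub>x\<^sub>x)\<^sub>y = (\<phi>\<^sub>x\<^sub>y)\<^sub>x\<close> and \<open>(\<phi>\<^sub>x\<^sub>x)\<^sub>z = (\<phi>\<^sub>x\<^sub>z)\<^sub>x\<close> then yield the three equations, the unknown functions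
  cancelling.

  Sufficiency: the equations force, locally, \<open>D = (C' / 2 + C\<^sup>2 / 4 + \<lambda> I) Y + k\<close> with \<open>\<lambda>\<close> and \<open>k\<close> functions
  of \<open>x\<close>. Solve \<open>P' = P C / 2\<close> and \<open>s'' = - \<lambda> s\<close>, and take \<open>r' = 1 / s\<^sup>2\<close>. Then \<open>u = r\<close>,
  \<open>(v, w) = P Y / s + b\<close>, for a suitable \<open>b\<close>, maps the system to the free particle system.\<close>

section \<open>Smooth maps\<close>

text \<open>Necessity, geometrically: a linearizing map turns the solution graphs into the
  unparametrised geodesics of the flat connection that it pulls back. Such paths fix a connection
  only up to a one-form, which accounts for the three unknown functions; the conditions are
  consequences of vanishing curvature in which that one-form cancels. The obstacle is that curves
  are tested only where \<open>du/dt\<close> is nonzero, so some directions \<open>(1, p, q)\<close>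
  give no direct information; an identity known off one line of the \<open>(p, q)\<close> plane is
  extended by continuity.

  Sufficiency: \<open>V = P Y\<close> with \<open>P' = P C / 2\<close> satisfies
  \<open>P (Y'' + C Y') = V'' - P (C' / 2 + C\<^sup>2 / 4) Y\<close>. This is why
  \<open>C' / 2 + C\<^sup>2 / 4\<close> is compared with the Jacobian of \<open>D\<close> in
  \<open>Y\<close>: the conditions say that the difference is a multiple of \<open>I\<close>. The
  system becomes \<open>V'' + \<lambda> V + P k = 0\<close>. Liouville's substitution
  \<open>V / s\<close>, \<open>r' = 1 / s\<^sup>2\<close> with \<open>s'' = - \<lambda> s\<close>
  removes the scalar term, and \<open>(s\<^sup>2 b')' = s P k\<close> absorbs the
  inhomogeneity.\<close>

lemma Ck_on_imp_continuous_on: "Ck_on k S f \<Longrightarrow> continuous_on S f"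
  by (cases k)
    (simp_all add: continuous_at_imp_continuous_on differentiable_imp_continuous_within)

text \<open>\<open>Ck_on (Suc k)\<close> asks for differentiability and for \<open>Ck_on k\<close>
  of every directional derivative, but not for \<open>Ck_on k\<close> of the map itself. That is
  recovered by induction, the base being continuity of differentiable maps.\<close>

lemma Ck_on_SucD: "Ck_on (Suc k) S f \<Longrightarrow> Ck_on k S f"
proof (induction k arbitrary: f)
  case 0
  then show ?case using Ck_on_imp_continuous_on[OF 0] by simp
next
  case (Suc k)
  then show ?case by (metis Ck_on.simps(2))
qed

lemma Ck_on_subset: "Ck_on k S f \<Longrightarrow> T \<subseteq> S \<Longrightarrow> Ck_on k T f"
proof (induction k arbitrary: f)
  case 0
  then show ?case by (auto intro: continuous_on_subset)
next
  case (Suc k)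
  then show ?case by auto
qed

text \<open>\<open>frechet_derivative\<close> picks one of the maps that satisfy
  \<open>has_derivative\<close>. These are the same maps for \<open>f\<close> and \<open>g\<close>,
  so the picks agree even where neither is differentiable.\<close>

lemma frechet_derivative_transform_open:
  assumes "open S" "x \<in> S" "\<And>y. y \<in> S \<Longrightarrow> f y = g y"
  shows "frechet_derivative f (at x) = frechet_derivative g (at x)"
proof -
  have "(f has_derivative D) (at x) \<longleftrightarrow> (g has_derivative D) (at x)" for D
    using assms has_derivative_transform_within_open[of f D x UNIV S g]
      has_derivative_transform_within_open[of g D x UNIV S f] by auto
  then show ?thesis
    by (simp add: frechet_derivative_def)
qed

lemma Ck_on_cong:
  assumes "open S" "\<And>x. x \<in> S \<Longrightarrow> f x = g x" "Ck_on k S f"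
  shows "Ck_on k S g"
  using assms(2,3)
proof (induction k arbitrary: f g)
  case 0
  then show ?case by (auto cong: continuous_on_cong)
next
  case (Suc k)
  have "g differentiable (at x)" if x: "x \<in> S" for x
  proof -
    obtain D where "(f has_derivative D) (at x)"
      using x Suc.prems(2) by (auto simp: differentiable_def)
    then show ?thesis
      using has_derivative_transform_within_open[of f D x UNIV S g] x Suc.prems(1) assms(1)
      unfolding differentiable_def by metis
  qed
  moreover have "Ck_on k S (\<lambda>x. frechet_derivative g (at x) h)" for h
  proof (rule Suc.IH)
    show "Ck_on k S (\<lambda>x. frechet_derivative f (at x) h)" using Suc.prems by simp
    show "frechet_derivative f (at x) h = frechet_derivative g (at x) h" if "x \<in> S" for x
      using frechet_derivative_transform_open[OF assms(1) that] Suc.prems(1) by metis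
  qed
  ultimately show ?case by simp
qed

text \<open>Lets a proof work with an explicit formula \<open>f'\<close>: derivatives are unique, so
  \<open>f'\<close> agrees on \<open>S\<close> with the chosen
  \<open>frechet_derivative\<close>.\<close>

lemma Ck_on_SucI:
  assumes "open S" "\<And>x. x \<in> S \<Longrightarrow> (f has_derivative f' x) (at x)"
    and "\<And>h. Ck_on k S (\<lambda>x. f' x h)"
  shows "Ck_on (Suc k) S f"
proof -
  have "frechet_derivative f (at x) = f' x" if "x \<in> S" for x
    using assms(2)[OF that] frechet_derivative_at by metis
  then have "Ck_on k S (\<lambda>x. frechet_derivative f (at x) h)" for h
    by (intro Ck_on_cong[OF assms(1) _ assms(3)[of h]]) simp
  then show ?thesis using assms(2) by (auto simp: differentiable_def)
qed

lemma Ck_on_has_derivative: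
  "Ck_on (Suc k) S f \<Longrightarrow> x \<in> S \<Longrightarrow> (f has_derivative frechet_derivative f (at x)) (at x)"
  by (simp add: frechet_derivative_works)

lemma Ck_on_const: "open S \<Longrightarrow> Ck_on k S (\<lambda>_. c)"
proof (induction k arbitrary: c)
  case (Suc k)
  then show ?case by (intro Ck_on_SucI[where f' = "\<lambda>_ _. 0"]) auto
qed auto

lemma Ck_on_bounded_linear:
  assumes "bounded_linear L" "open S"
  shows "Ck_on k S L"
proof (cases k)
  case 0
  then show ?thesis using assms(1) by (simp add: linear_continuous_on)
next
  case (Suc n)
  show ?thesis
    unfolding Suc
  proof (rule Ck_on_SucI[OF assms(2)])
    show "(L has_derivative L) (at x)" for x
      using assms(1) by (rule bounded_linear_imp_has_derivative)
  qed (rule Ck_on_const[OF assms(2)])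
qed

lemma Ck_on_linear_compose:
  "bounded_linear L \<Longrightarrow> open S \<Longrightarrow> Ck_on k S f \<Longrightarrow> Ck_on k S (\<lambda>x. L (f x))"
proof (induction k arbitrary: f)
  case 0
  then show ?case by (auto intro: bounded_linear.continuous_on)
next
  case (Suc k)
  show ?case
  proof (rule Ck_on_SucI[OF \<open>open S\<close>])
    fix x assume "x \<in> S"
    show "((\<lambda>x. L (f x)) has_derivative (\<lambda>h. L (frechet_derivative f (at x) h))) (at x)"
      by (rule bounded_linear.has_derivative[OF Suc.prems(1) Ck_on_has_derivative[OF Suc.prems(3) \<open>x \<in> S\<close>]])
  next
    show "Ck_on k S (\<lambda>x. L (frechet_derivative f (at x) h))" for h
      using Suc.IH[OF Suc.prems(1,2)] Suc.prems(3) by simp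
  qed
qed

lemma Ck_on_add:
  "open S \<Longrightarrow> Ck_on k S f \<Longrightarrow> Ck_on k S g \<Longrightarrow> Ck_on k S (\<lambda>x. f x + g x)"
proof (induction k arbitrary: f g)
  case 0
  then show ?case by (auto intro: continuous_on_add)
next
  case (Suc k)
  show ?case
  proof (rule Ck_on_SucI[OF \<open>open S\<close>])
    fix x assume "x \<in> S"
    show "((\<lambda>x. f x + g x) has_derivative
        (\<lambda>h. frechet_derivative f (at x) h + frechet_derivative g (at x) h)) (at x)"
      by (intro has_derivative_add Ck_on_has_derivative[OF Suc.prems(2) \<open>x \<in> S\<close>]
          Ck_on_has_derivative[OF Suc.prems(3) \<open>x \<in> S\<close>])
  next
    show "Ck_on k S (\<lambda>x. frechet_derivative f (at x) h + frechet_derivative g (at x) h)" for h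
      using Suc.IH Suc.prems by simp
  qed
qed

lemma Ck_on_scaleR:
  "open S \<Longrightarrow> Ck_on k S f \<Longrightarrow> Ck_on k S g \<Longrightarrow> Ck_on k S (\<lambda>x. f x *\<^sub>R g x)"
proof (induction k arbitrary: f g)
  case 0
  then show ?case by (auto intro: continuous_on_scaleR)
next
  case (Suc k)
  show ?case
  proof (rule Ck_on_SucI[OF \<open>open S\<close>])
    fix x assume "x \<in> S"
    show "((\<lambda>x. f x *\<^sub>R g x) has_derivative
        (\<lambda>h. f x *\<^sub>R frechet_derivative g (at x) h + frechet_derivative f (at x) h *\<^sub>R g x)) (at x)"
      by (intro has_derivative_scaleR Ck_on_has_derivative[OF Suc.prems(2) \<open>x \<in> S\<close>]
          Ck_on_has_derivative[OF Suc.prems(3) \<open>x \<in> S\<close>])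
  next
    show "Ck_on k S (\<lambda>x. f x *\<^sub>R frechet_derivative g (at x) h + frechet_derivative f (at x) h *\<^sub>R g x)" for h
      using Suc.prems by (auto intro!: Ck_on_add Suc.IH Ck_on_SucD[of _ _ f] Ck_on_SucD[of _ _ g] simp del: Ck_on.simps(2))
       (simp_all)
  qed
qed

lemma Ck_on_mult:
  fixes f g :: "'a::real_normed_vector \<Rightarrow> real"
  shows "open S \<Longrightarrow> Ck_on k S f \<Longrightarrow> Ck_on k S g \<Longrightarrow> Ck_on k S (\<lambda>x. f x * g x)"
  using Ck_on_scaleR[of S k f g] by simp

lemma Ck_on_sum:
  "open S \<Longrightarrow> finite A \<Longrightarrow> (\<And>i. i \<in> A \<Longrightarrow> Ck_on k S (f i)) \<Longrightarrow> Ck_on k S (\<lambda>x. \<Sum>i\<in>A. f i x)"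
proof (induction A rule: infinite_finite_induct)
  case (insert i A)
  then show ?case by (simp add: Ck_on_add)
qed (simp_all add: Ck_on_const)

text \<open>In the chain rule \<open>g' (f x) (f' x h)\<close> the argument of the linear map moves
  with \<open>x\<close>, while \<open>Ck_on\<close> speaks about fixed directions. Expanding the
  argument in \<open>Basis\<close> leaves sums of products of C^k functions; this is what the
  Euclidean intermediate space is for.\<close>

lemma Ck_on_compose:
  fixes f :: "'a::real_normed_vector \<Rightarrow> 'b::euclidean_space"
    and g :: "'b \<Rightarrow> 'c::real_normed_vector"
  shows "open S \<Longrightarrow> Ck_on k S f \<Longrightarrow> Ck_on k T g \<Longrightarrow> f ` S \<subseteq> T \<Longrightarrow> Ck_on k S (\<lambda>x. g (f x))"
proof (induction k arbitrary: g)
  case 0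
  then show ?case by (auto intro: continuous_on_compose2)
next
  case (Suc k)
  let ?f' = "\<lambda>x. frechet_derivative f (at x)" and ?g' = "\<lambda>x. frechet_derivative g (at x)"
  have f': "(f has_derivative ?f' x) (at x)" and g': "(g has_derivative ?g' (f x)) (at (f x))"
    if "x \<in> S" for x
    using that Suc.prems(4) Ck_on_has_derivative[OF Suc.prems(2)] Ck_on_has_derivative[OF Suc.prems(3)]
    by (auto simp del: Ck_on.simps)
  have expand: "?g' (f x) v = (\<Sum>b\<in>Basis. (v \<bullet> b) *\<^sub>R ?g' (f x) b)" if "x \<in> S" for x v
  proof -
    have "linear (?g' (f x))"
      by (rule has_derivative_linear[OF g'[OF that]])
    then have "?g' (f x) (\<Sum>b\<in>Basis. (v \<bullet> b) *\<^sub>R b) = (\<Sum>b\<in>Basis. (v \<bullet> b) *\<^sub>R ?g' (f x) b)"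
      by (simp add: linear_sum linear_cmul)
    then show ?thesis
      by (simp only: euclidean_representation)
  qed
  show ?case
  proof (rule Ck_on_SucI[OF \<open>open S\<close>])
    fix x assume "x \<in> S"
    show "((\<lambda>x. g (f x)) has_derivative (\<lambda>h. ?g' (f x) (?f' x h))) (at x)"
      by (rule has_derivative_compose[OF f'[OF \<open>x \<in> S\<close>] g'[OF \<open>x \<in> S\<close>]])
  next
    fix h
    have "Ck_on k S (\<lambda>x. \<Sum>b\<in>Basis. (?f' x h \<bullet> b) *\<^sub>R ?g' (f x) b)"
    proof (intro Ck_on_sum Ck_on_scaleR)
      show "Ck_on k S (\<lambda>x. ?f' x h \<bullet> b)" for b
        using Suc.prems by (intro Ck_on_linear_compose[OF bounded_linear_inner_left]) auto
      show "Ck_on k S (\<lambda>x. ?g' (f x) b)" for b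
        using Suc.prems Ck_on_SucD[OF Suc.prems(2)] by (intro Suc.IH) auto
    qed (use Suc.prems in auto)
    then show "Ck_on k S (\<lambda>x. ?g' (f x) (?f' x h))"
      by (rule Ck_on_cong[OF \<open>open S\<close>, rotated]) (simp add: expand)
  qed
qed

text \<open>The derivative is a polynomial in \<open>inverse\<close> itself, so the induction
  hypothesis covers it.\<close>

lemma Ck_on_inverse_real: "Ck_on k (- {0::real}) inverse"
proof (induction k)
  case 0
  then show ?case by (auto intro: continuous_on_inverse)
next
  case (Suc k)
  show ?case
  proof (rule Ck_on_SucI)
    fix x :: real assume "x \<in> - {0}"
    then show "(inverse has_derivative (\<lambda>h. (- h) * (inverse x * inverse x))) (at x)"
      by (auto intro!: derivative_eq_intros simp: mult_ac)
  next
    show "Ck_on k (- {0}) (\<lambda>x::real. (- h) * (inverse x * inverse x))" for h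
      by (intro Ck_on_mult Ck_on_const Suc.IH) auto
  qed auto
qed

section \<open>Closure properties of smooth maps, inherited from C^k maps\<close>

lemma smooth_onI: "(\<And>k. Ck_on k S f) \<Longrightarrow> smooth_on S f"
  by (simp add: smooth_on_def)

lemma smooth_onD: "smooth_on S f \<Longrightarrow> Ck_on k S f"
  by (simp add: smooth_on_def)

lemma smooth_on_subset: "smooth_on S f \<Longrightarrow> T \<subseteq> S \<Longrightarrow> smooth_on T f"
  by (rule smooth_onI, rule Ck_on_subset) (auto intro: smooth_onD)

lemma smooth_on_cong:
  "open S \<Longrightarrow> smooth_on S f \<Longrightarrow> (\<And>x. x \<in> S \<Longrightarrow> f x = g x) \<Longrightarrow> smooth_on S g"
  by (rule smooth_onI, rule Ck_on_cong[of S f]) (auto intro: smooth_onD)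

lemma smooth_on_imp_continuous_on: "smooth_on S f \<Longrightarrow> continuous_on S f"
  by (rule Ck_on_imp_continuous_on, rule smooth_onD)

lemma smooth_on_const: "open S \<Longrightarrow> smooth_on S (\<lambda>_. c)"
  by (rule smooth_onI, rule Ck_on_const)

lemma smooth_on_bounded_linear: "bounded_linear L \<Longrightarrow> open S \<Longrightarrow> smooth_on S L"
  by (rule smooth_onI, rule Ck_on_bounded_linear)

lemma smooth_on_linear_compose:
  "bounded_linear L \<Longrightarrow> open S \<Longrightarrow> smooth_on S f \<Longrightarrow> smooth_on S (\<lambda>x. L (f x))"
  by (rule smooth_onI, rule Ck_on_linear_compose) (auto intro: smooth_onD)

lemma smooth_on_ident: "open S \<Longrightarrow> smooth_on S (\<lambda>x. x)"
  by (rule smooth_on_bounded_linear) (rule bounded_linear_ident)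

lemma smooth_on_fst: "open S \<Longrightarrow> smooth_on S f \<Longrightarrow> smooth_on S (\<lambda>x. fst (f x))"
  by (rule smooth_on_linear_compose) (rule bounded_linear_fst)

lemma smooth_on_snd: "open S \<Longrightarrow> smooth_on S f \<Longrightarrow> smooth_on S (\<lambda>x. snd (f x))"
  by (rule smooth_on_linear_compose) (rule bounded_linear_snd)

lemma smooth_on_add: "open S \<Longrightarrow> smooth_on S f \<Longrightarrow> smooth_on S g \<Longrightarrow> smooth_on S (\<lambda>x. f x + g x)"
  by (rule smooth_onI, rule Ck_on_add) (auto intro: smooth_onD)

lemma smooth_on_scaleR:
  "open S \<Longrightarrow> smooth_on S f \<Longrightarrow> smooth_on S g \<Longrightarrow> smooth_on S (\<lambda>x. f x *\<^sub>R g x)"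
  by (rule smooth_onI, rule Ck_on_scaleR) (auto intro: smooth_onD)

lemma smooth_on_mult:
  fixes f g :: "'a::real_normed_vector \<Rightarrow> real"
  shows "open S \<Longrightarrow> smooth_on S f \<Longrightarrow> smooth_on S g \<Longrightarrow> smooth_on S (\<lambda>x. f x * g x)"
  by (rule smooth_onI, rule Ck_on_mult) (auto intro: smooth_onD)

lemma smooth_on_minus: "open S \<Longrightarrow> smooth_on S f \<Longrightarrow> smooth_on S (\<lambda>x. - f x)"
  by (rule smooth_on_linear_compose) (intro bounded_linear_minus bounded_linear_ident)

lemma smooth_on_diff: "open S \<Longrightarrow> smooth_on S f \<Longrightarrow> smooth_on S g \<Longrightarrow> smooth_on S (\<lambda>x. f x - g x)"
  using smooth_on_add[of S f "\<lambda>x. - g x"] smooth_on_minus[of S g] by simp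

lemma smooth_on_Pair:
  fixes f :: "'a::real_normed_vector \<Rightarrow> 'b::real_normed_vector"
    and g :: "'a \<Rightarrow> 'c::real_normed_vector"
  assumes "open S" "smooth_on S f" "smooth_on S g"
  shows "smooth_on S (\<lambda>x. (f x, g x))"
proof -
  have "bounded_linear (\<lambda>y::'b. (y, 0::'c))" "bounded_linear (\<lambda>y::'c. (0::'b, y))"
    by (intro bounded_linear_Pair bounded_linear_ident bounded_linear_zero)+
  then have "smooth_on S (\<lambda>x. (f x, 0::'c))" "smooth_on S (\<lambda>x. (0::'b, g x))"
    using smooth_on_linear_compose[OF _ assms(1,2), of "\<lambda>y. (y, 0::'c)"]
      smooth_on_linear_compose[OF _ assms(1,3), of "\<lambda>y. (0::'b, y)"] by auto
  then have "smooth_on S (\<lambda>x. (f x, 0) + (0, g x))"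
    by (rule smooth_on_add[OF assms(1)])
  then show ?thesis by simp
qed

lemma smooth_on_compose:
  fixes f :: "'a::real_normed_vector \<Rightarrow> 'b::euclidean_space"
    and g :: "'b \<Rightarrow> 'c::real_normed_vector"
  shows "open S \<Longrightarrow> smooth_on T g \<Longrightarrow> smooth_on S f \<Longrightarrow> f ` S \<subseteq> T \<Longrightarrow> smooth_on S (\<lambda>x. g (f x))"
  by (rule smooth_onI, rule Ck_on_compose) (auto intro: smooth_onD)

lemma smooth_on_divide:
  fixes f g :: "'a::real_normed_vector \<Rightarrow> real"
  assumes "open S" "smooth_on S f" "smooth_on S g" "\<And>x. x \<in> S \<Longrightarrow> g x \<noteq> 0"
  shows "smooth_on S (\<lambda>x. f x / g x)"
proof -
  have "smooth_on S (\<lambda>x. inverse (g x))"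
    by (rule smooth_on_compose[OF assms(1) smooth_onI[OF Ck_on_inverse_real] assms(3)]) (use assms(4) in auto)
  then show ?thesis
    using smooth_on_mult[OF assms(1,2)] by (simp add: divide_inverse)
qed

lemmas smooth_intros = smooth_on_const smooth_on_ident smooth_on_fst smooth_on_snd smooth_on_add
  smooth_on_diff smooth_on_minus smooth_on_mult smooth_on_scaleR smooth_on_divide smooth_on_Pair

lemma smooth_on_has_derivative:
  "smooth_on S f \<Longrightarrow> x \<in> S \<Longrightarrow> (f has_derivative frechet_derivative f (at x)) (at x)"
  by (rule Ck_on_has_derivative[OF smooth_onD])

lemma smooth_on_frechet_derivative:
  "smooth_on S f \<Longrightarrow> smooth_on S (\<lambda>x. frechet_derivative f (at x) h)"
  unfolding smooth_on_def using Ck_on.simps(2)[of _ S f] by simp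

section \<open>Smooth functions of one real variable\<close>

lemma frechet_derivative_real:
  fixes f :: "real \<Rightarrow> real"
  assumes "f differentiable (at x)"
  shows "(f has_real_derivative frechet_derivative f (at x) 1) (at x)"
proof -
  have D: "(f has_derivative frechet_derivative f (at x)) (at x)"
    using assms by (simp add: frechet_derivative_works)
  then have "frechet_derivative f (at x) h = frechet_derivative f (at x) 1 * h" for h
    using linear_cmul[OF has_derivative_linear[OF D], of h 1] by (simp add: mult.commute)
  then have "frechet_derivative f (at x) = (\<lambda>h. frechet_derivative f (at x) 1 * h)"
    by (rule ext)
  then show ?thesis
    using D unfolding has_field_derivative_def by metis
qed

lemma smooth_on_has_real_derivative:
  fixes f :: "real \<Rightarrow> real"
  assumes "smooth_on S f" "x \<in> S"
  shows "(f has_real_derivative deriv f x) (at x)"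
proof -
  have "f differentiable (at x)"
    using smooth_on_has_derivative[OF assms] by (auto simp: differentiable_def)
  then show ?thesis
    by (simp add: DERIV_deriv_iff_real_differentiable)
qed

lemma smooth_on_deriv:
  fixes f :: "real \<Rightarrow> real"
  assumes "open S" "smooth_on S f"
  shows "smooth_on S (deriv f)"
proof (rule smooth_on_cong[OF assms(1) smooth_on_frechet_derivative[OF assms(2), of 1]])
  fix x assume "x \<in> S"
  then show "frechet_derivative f (at x) 1 = deriv f x"
    using frechet_derivative_real[of f x] smooth_on_has_real_derivative[OF assms(2)]
    by (metis DERIV_unique real_differentiable_def)
qed

lemma Ck_on_Suc_real:
  fixes f :: "real \<Rightarrow> real"
  assumes "open S" "\<And>x. x \<in> S \<Longrightarrow> (f has_real_derivative f' x) (at x)" "Ck_on k S f'"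
  shows "Ck_on (Suc k) S f"
proof (rule Ck_on_SucI[OF assms(1)])
  show "(f has_derivative (\<lambda>h. f' x * h)) (at x)" if "x \<in> S" for x
    using assms(2)[OF that] by (simp add: has_field_derivative_def)
  show "Ck_on k S (\<lambda>x. f' x * h)" for h
    using assms by (intro Ck_on_mult Ck_on_const)
qed

lemma smooth_on_real_antiderivative:
  fixes f :: "real \<Rightarrow> real"
  assumes "open S" "\<And>x. x \<in> S \<Longrightarrow> (f has_real_derivative f' x) (at x)" "smooth_on S f'"
  shows "smooth_on S f"
proof (rule smooth_onI)
  show "Ck_on k S f" for k
    by (rule Ck_on_SucD, rule Ck_on_Suc_real[OF assms(1,2)], assumption) (rule smooth_onD[OF assms(3)])
qed

section \<open>Inverse functions and linear ODEs on the line\<close>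

text \<open>A positive derivative makes \<open>r\<close> strictly increasing on the interval, hence
  injective. Invariance of domain and the strong inverse function theorem then work from the
  continuity of \<open>r\<close>; continuity of the inverse need not be shown beforehand.\<close>

lemma inverse_function_real:
  fixes r :: "real \<Rightarrow> real"
  assumes J: "open J" "is_interval J"
    and r: "\<And>t. t \<in> J \<Longrightarrow> (r has_real_derivative r' t) (at t)"
    and pos: "\<And>t. t \<in> J \<Longrightarrow> r' t > 0"
  obtains g where "\<And>t. t \<in> J \<Longrightarrow> g (r t) = t"
    and "\<And>t. t \<in> J \<Longrightarrow> (g has_real_derivative 1 / r' t) (at (r t))"
    and "open (r ` J)" "is_interval (r ` J)"
proof
  let ?g = "inv_into J r"
  have cont: "continuous_on J r"
    by (rule DERIV_continuous_on, rule has_field_derivative_at_within, rule r)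
  have less: "r a < r b" if "a \<in> J" "b \<in> J" "a < b" for a b
  proof (rule DERIV_pos_imp_increasing[OF \<open>a < b\<close>])
    fix t assume "a \<le> t" "t \<le> b"
    then have "t \<in> J" using mem_is_interval_1_I[OF J(2) that(1,2)] by blast
    then show "\<exists>y. (r has_real_derivative y) (at t) \<and> 0 < y" using r pos by blast
  qed
  have inj: "inj_on r J"
    by (rule inj_onI) (metis less less_irrefl linorder_neqE)
  show inv: "?g (r t) = t" if "t \<in> J" for t
    using inj that by simp
  show "open (r ` J)"
    by (rule invariance_of_domain[OF cont J(1) inj])
  show "is_interval (r ` J)"
    using J(2) cont connected_continuous_image is_interval_connected_1 by blast
  show "(?g has_real_derivative 1 / r' t) (at (r t))" if "t \<in> J" for t
    unfolding has_field_derivative_def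
    by (rule has_derivative_inverse_strong[OF J(1) that cont inv
          r[OF that, unfolded has_field_derivative_def]])
      (use pos[OF that] in \<open>auto simp: fun_eq_iff\<close>)
qed

lemma constant_derivative_imp_linear:
  fixes f :: "real \<Rightarrow> real"
  assumes "is_interval S" "t \<in> S" "t0 \<in> S"
    and "\<And>s. s \<in> S \<Longrightarrow> (f has_real_derivative c) (at s)"
  shows "f t = f t0 + c * (t - t0)"
proof -
  have "((\<lambda>s. f s - c * (s - t0)) has_real_derivative 0) (at s within S)" if "s \<in> S" for s
    using has_field_derivative_at_within[OF assms(4)[OF that], of S]
    by (auto intro!: derivative_eq_intros)
  then have "\<exists>d. \<forall>s\<in>S. f s - c * (s - t0) = d"
    using assms(1) by (intro has_field_derivative_zero_constant) (auto simp: is_interval_convex_1)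
  then have "f t - c * (t - t0) = f t0 - c * (t0 - t0)"
    using assms(2,3) by metis
  then show ?thesis by simp
qed

lemma antiderivative_ball:
  fixes f :: "real \<Rightarrow> real"
  assumes "open S" "t0 \<in> S" "continuous_on S f"
  obtains \<delta> F where "\<delta> > 0" "ball t0 \<delta> \<subseteq> S"
    "\<And>t. t \<in> ball t0 \<delta> \<Longrightarrow> (F has_real_derivative f t) (at t)"
proof -
  obtain \<delta> where d: "\<delta> > 0" "cball t0 \<delta> \<subseteq> S"
    using assms open_contains_cball by blast
  have "continuous_on {t0-\<delta>..t0+\<delta>} f"
    using assms(3) d by (simp add: cball_eq_atLeastAtMost continuous_on_subset)
  then have F: "((\<lambda>x. integral {t0-\<delta>..x} f) has_real_derivative f t) (at t within {t0-\<delta>..t0+\<delta>})"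
    if "t \<in> {t0-\<delta>..t0+\<delta>}" for t using that by (rule integral_has_real_derivative)
  show ?thesis
  proof (rule that[OF d(1)])
    show "ball t0 \<delta> \<subseteq> S" using d(2) ball_subset_cball by blast
    show "((\<lambda>x. integral {t0-\<delta>..x} f) has_real_derivative f t) (at t)" if "t \<in> ball t0 \<delta>" for t
      using F[of t] that at_within_Icc_at[of "t0-\<delta>" t "t0+\<delta>"] by (simp add: dist_real_def abs_less_iff)
  qed
qed

text \<open>Picard iteration, organised as a series whose terms are successive antiderivatives.\<close>

lemma linear_ode_2:
  fixes a b c d :: "real \<Rightarrow> real"
  assumes "open S" "t0 \<in> S"
    and "continuous_on S a" "continuous_on S b" "continuous_on S c" "continuous_on S d"
  obtains \<delta> X Y where "\<delta> > 0" "ball t0 \<delta> \<subseteq> S" "X t0 = x0" "Y t0 = y0"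
    "\<And>t. t \<in> ball t0 \<delta> \<Longrightarrow> (X has_real_derivative a t * X t + b t * Y t) (at t)"
    "\<And>t. t \<in> ball t0 \<delta> \<Longrightarrow> (Y has_real_derivative c t * X t + d t * Y t) (at t)"
proof -
  obtain \<rho> where \<rho>: "\<rho> > 0" "cball t0 \<rho> \<subseteq> S"
    using assms open_contains_cball by blast
  have "\<exists>M. \<forall>t\<in>cball t0 \<rho>. \<bar>f t\<bar> \<le> M" if "continuous_on S f" for f :: "real \<Rightarrow> real"
    using compact_continuous_image[OF continuous_on_subset[OF that \<rho>(2)] compact_cball]
      compact_imp_bounded bounded_real by (metis imageI)
  then obtain Ma Mb Mc Md where
    Ma: "\<And>t. t \<in> cball t0 \<rho> \<Longrightarrow> \<bar>a t\<bar> \<le> Ma" and Mb: "\<And>t. t \<in> cball t0 \<rho> \<Longrightarrow> \<bar>b t\<bar> \<le> Mb"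
    and Mc: "\<And>t. t \<in> cball t0 \<rho> \<Longrightarrow> \<bar>c t\<bar> \<le> Mc" and Md: "\<And>t. t \<in> cball t0 \<rho> \<Longrightarrow> \<bar>d t\<bar> \<le> Md"
    using assms(3-6) by metis
  define M where "M = max (max (max Ma Mb) (max Mc Md)) 1"
  have M: "M \<ge> 1" "\<And>t. t \<in> cball t0 \<rho> \<Longrightarrow> \<bar>a t\<bar> \<le> M" "\<And>t. t \<in> cball t0 \<rho> \<Longrightarrow> \<bar>b t\<bar> \<le> M"
    "\<And>t. t \<in> cball t0 \<rho> \<Longrightarrow> \<bar>c t\<bar> \<le> M" "\<And>t. t \<in> cball t0 \<rho> \<Longrightarrow> \<bar>d t\<bar> \<le> M"
    using Ma Mb Mc Md unfolding M_def by (simp_all add: le_max_iff_disj)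
  \<comment> \<open>One Picard step multiplies a common bound of both components by at most
    \<open>2 * M * \<delta>\<close>; this choice makes the factor at most 1/2.\<close>
  define \<delta> where "\<delta> = min \<rho> (1 / (4 * M))"
  have \<delta>: "\<delta> > 0" "\<delta> \<le> \<rho>" "M * \<delta> \<le> 1/4"
  proof -
    show "\<delta> > 0" "\<delta> \<le> \<rho>" using \<rho> M(1) by (auto simp: \<delta>_def)
    have "M * \<delta> \<le> M * (1 / (4 * M))" using M(1) unfolding \<delta>_def by (intro mult_left_mono) auto
    then show "M * \<delta> \<le> 1/4" using M(1) by simp
  qed
  let ?I = "{t0-\<delta>..t0+\<delta>}"
  have I: "?I \<subseteq> cball t0 \<rho>" "t0 \<in> ?I"
    using \<delta> by (auto simp: dist_real_def)
  then have I: "?I \<subseteq> cball t0 \<rho>" "?I \<subseteq> S" "t0 \<in> ?I"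
    using \<rho>(2) by (auto simp del: mem_cball)
  have cont: "continuous_on ?I a" "continuous_on ?I b" "continuous_on ?I c" "continuous_on ?I d"
    using assms(3-6) I(2) continuous_on_subset by blast+
  \<comment> \<open>Integrals start at the left end and are shifted to vanish at \<open>t0\<close>,
    so that one formula serves both sides of \<open>t0\<close>.\<close>
  define A where "A f t = integral {t0-\<delta>..t} f - integral {t0-\<delta>..t0} f" for f :: "real \<Rightarrow> real" and t
  have A: "(A f has_real_derivative f t) (at t within ?I)" if "continuous_on ?I f" "t \<in> ?I" for f t
    unfolding A_def using integral_has_real_derivative[OF that] by (auto intro!: derivative_eq_intros)
  have A0: "A f t0 = 0" for f by (simp add: A_def)
  have A_bound: "\<bar>A f t\<bar> \<le> B * \<delta>" if f: "continuous_on ?I f" and t: "t \<in> ?I"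
    and B: "\<And>s. s \<in> ?I \<Longrightarrow> \<bar>f s\<bar> \<le> B" for f t B
  proof -
    have "norm (A f t - A f t0) \<le> B * norm (t - t0)"
      by (rule field_differentiable_bound[OF _ A[OF f]]) (use B t I(3) in auto)
    also have "\<dots> \<le> B * \<delta>"
      using B[OF t] t by (intro mult_left_mono) auto
    finally show ?thesis by (simp add: A0)
  qed
  \<comment> \<open>The solution is the sum of the \<open>x n\<close>, \<open>y n\<close>: term 0
    carries the initial values, and each later term is the primitive, zero at \<open>t0\<close>, of
    the right-hand side evaluated at the preceding one.\<close>
  define P where "P = rec_nat (\<lambda>_::real. x0, \<lambda>_::real. y0)
    (\<lambda>_ (x, y). (A (\<lambda>t. a t * x t + b t * y t), A (\<lambda>t. c t * x t + d t * y t)))"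
  define x where "x n = fst (P n)" for n
  define y where "y n = snd (P n)" for n
  have xy0: "x 0 = (\<lambda>_. x0)" "y 0 = (\<lambda>_. y0)"
    by (simp_all add: x_def y_def P_def)
  have xyS: "x (Suc n) = A (\<lambda>t. a t * x n t + b t * y n t)"
    "y (Suc n) = A (\<lambda>t. c t * x n t + d t * y n t)" for n
    by (simp_all add: x_def y_def P_def case_prod_beta)
  define K where "K = \<bar>x0\<bar> + \<bar>y0\<bar>"
  have main: "continuous_on ?I (x n) \<and> continuous_on ?I (y n) \<and>
    (\<forall>t\<in>?I. \<bar>x n t\<bar> \<le> K * (1/2)^n \<and> \<bar>y n t\<bar> \<le> K * (1/2)^n)" for n
  proof (induction n)
    case 0
    then show ?case by (auto simp: xy0 K_def)
  next
    case (Suc n)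
    have c: "continuous_on ?I (\<lambda>t. a t * x n t + b t * y n t)"
      "continuous_on ?I (\<lambda>t. c t * x n t + d t * y n t)"
      using Suc cont by (auto intro!: continuous_intros)
    have K: "K \<ge> 0" by (simp add: K_def)
    have bound: "\<bar>p * x n t + q * y n t\<bar> \<le> 2 * M * (K * (1/2)^n)"
      if "t \<in> ?I" "\<bar>p\<bar> \<le> M" "\<bar>q\<bar> \<le> M" for t p q
    proof -
      have "\<bar>p * x n t\<bar> \<le> M * (K * (1/2)^n)" "\<bar>q * y n t\<bar> \<le> M * (K * (1/2)^n)"
        using Suc that M(1) unfolding abs_mult by (auto intro!: mult_mono)
      then show ?thesis by linarith
    qed
    have fin: "2 * M * (K * (1/2)^n) * \<delta> \<le> K * (1/2)^Suc n"
    proof -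
      have "2 * M * (K * (1/2)^n) * \<delta> = (M * \<delta>) * (2 * K * (1/2)^n)" by simp
      also have "\<dots> \<le> 1/4 * (2 * K * (1/2)^n)"
        using \<delta>(3) K by (intro mult_right_mono) auto
      finally show ?thesis by simp
    qed
    have "\<bar>x (Suc n) t\<bar> \<le> K * (1/2)^Suc n" "\<bar>y (Suc n) t\<bar> \<le> K * (1/2)^Suc n" if "t \<in> ?I" for t
    proof -
      have "\<bar>a s * x n s + b s * y n s\<bar> \<le> 2 * M * (K * (1/2)^n)"
        "\<bar>c s * x n s + d s * y n s\<bar> \<le> 2 * M * (K * (1/2)^n)" if "s \<in> ?I" for s
        using that I(1) M(2-5) by (simp_all add: bound subset_iff del: mem_cball)
      then show "\<bar>x (Suc n) t\<bar> \<le> K * (1/2)^Suc n" "\<bar>y (Suc n) t\<bar> \<le> K * (1/2)^Suc n"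
        unfolding xyS using order_trans[OF A_bound[OF c(1) that] fin]
          order_trans[OF A_bound[OF c(2) that] fin] by simp_all
    qed
    moreover have "continuous_on ?I (x (Suc n))" "continuous_on ?I (y (Suc n))"
      unfolding xyS using DERIV_continuous_on[OF A[OF c(1)]] DERIV_continuous_on[OF A[OF c(2)]]
      by simp_all
    ultimately show ?case by blast
  qed
  have summ: "summable (\<lambda>n. K * (1/2::real)^n)"
    by (intro summable_mult summable_geometric) simp
  have sx: "summable (\<lambda>n. x n t)" "summable (\<lambda>n. y n t)" if "t \<in> ?I" for t
    using main that by (auto intro!: summable_comparison_test[OF _ summ] exI[of _ 0])
  have deriv_series: "((\<lambda>s. \<Sum>n. u n s) has_real_derivative p t * (\<Sum>n. x n t) + q t * (\<Sum>n. y n t)) (at t)"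
    if u0: "\<And>s. u 0 s = k" and uS: "\<And>n. u (Suc n) = A (\<lambda>t. p t * x n t + q t * y n t)"
      and pq: "continuous_on ?I p" "continuous_on ?I q"
      and bd: "\<And>s. s \<in> ?I \<Longrightarrow> \<bar>p s\<bar> \<le> M" "\<And>s. s \<in> ?I \<Longrightarrow> \<bar>q s\<bar> \<le> M"
      and su: "summable (\<lambda>n. u n t0)"
      and t: "t \<in> ball t0 \<delta>" for u p q k t
  proof -
    \<comment> \<open>Termwise derivatives: term 0 of \<open>u\<close> is constant, and
      \<open>u (Suc m)\<close> is a primitive of the combination of the terms with index
      \<open>m\<close>.\<close>
    define v where "v n s = (case n of 0 \<Rightarrow> 0 | Suc m \<Rightarrow> p s * x m s + q s * y m s)" for n s
    have tI: "t \<in> interior ?I" "t \<in> ?I" using t by (auto simp: dist_real_def)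
    have der: "((\<lambda>s. \<Sum>n. u n s) has_real_derivative (\<Sum>n. v n t)) (at t)"
    proof (rule has_field_derivative_series'(2)[of ?I u v t0])
      show "(u n has_real_derivative v n s) (at s within ?I)" if "s \<in> ?I" for n s
      proof (cases n)
        case 0
        have "u 0 = (\<lambda>_. k)" using u0 by blast
        then show ?thesis by (simp add: 0 v_def)
      next
        case (Suc m)
        have "continuous_on ?I (\<lambda>t. p t * x m t + q t * y m t)"
          using main pq by (auto intro!: continuous_intros)
        then show ?thesis using A that by (simp add: Suc uS v_def)
      qed
      show "uniformly_convergent_on ?I (\<lambda>n s. \<Sum>i<n. v i s)"
      proof (rule Weierstrass_m_test')
        \<comment> \<open>The bound for \<open>v (Suc m)\<close> is
          \<open>2 * M * (K * (1/2)^m)\<close>; expressing it through \<open>n = Suc m\<close>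
          doubles the constant.\<close>
        show "norm (v n s) \<le> 4 * M * (K * (1/2)^n)" if "s \<in> ?I" for n s
        proof (cases n)
          case 0
          then show ?thesis using M(1) by (simp add: v_def K_def)
        next
          case (Suc m)
          have "\<bar>p s * x m s\<bar> \<le> M * (K * (1/2)^m)" "\<bar>q s * y m s\<bar> \<le> M * (K * (1/2)^m)"
            using main[of m] that M(1) bd unfolding abs_mult by (auto intro!: mult_mono)
          then have "\<bar>p s * x m s + q s * y m s\<bar> \<le> 2 * (M * (K * (1/2)^m))" by linarith
          then show ?thesis by (simp add: Suc v_def mult_ac)
        qed
        show "summable (\<lambda>n. 4 * M * (K * (1/2)^n))"
          using summ by (rule summable_mult)
      qed
    qed (use tI su I in auto)
    have "(\<lambda>n. p t * x n t + q t * y n t) sums (p t * (\<Sum>n. x n t) + q t * (\<Sum>n. y n t))"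
      using sx[OF tI(2)] by (intro sums_add sums_mult summable_sums)
    then have "(\<lambda>n. v (Suc n) t) sums (p t * (\<Sum>n. x n t) + q t * (\<Sum>n. y n t))"
      by (simp add: v_def)
    then have "(\<lambda>n. v n t) sums (p t * (\<Sum>n. x n t) + q t * (\<Sum>n. y n t) + v 0 t)"
      by (rule sums_Suc)
    then show ?thesis using der by (simp add: v_def sums_iff)
  qed
  show ?thesis
  proof (rule that[OF \<delta>(1)])
    show "ball t0 \<delta> \<subseteq> S"
      using I(2) by (simp add: subset_iff dist_real_def abs_less_iff)
    have at0: "x (Suc n) t0 = 0" "y (Suc n) t0 = 0" for n by (simp_all add: xyS A0)
    have "(\<lambda>n. x n t0) sums x 0 t0" "(\<lambda>n. y n t0) sums y 0 t0"
      using sums_finite[of "{0}" "\<lambda>n. x n t0"] sums_finite[of "{0}" "\<lambda>n. y n t0"] at0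
      by (metis (no_types, lifting) finite.emptyI finite.insertI insertI1 not0_implies_Suc sum.insert sum.empty empty_iff add.right_neutral)+
    then show "(\<Sum>n. x n t0) = x0" "(\<Sum>n. y n t0) = y0"
      by (simp_all add: xy0 sums_iff)
  next
    fix t assume t: "t \<in> ball t0 \<delta>"
    show "((\<lambda>t. \<Sum>n. x n t) has_real_derivative a t * (\<Sum>n. x n t) + b t * (\<Sum>n. y n t)) (at t)"
      by (rule deriv_series[OF _ xyS(1) cont(1,2) _ _ sx(1)[OF I(3)] t]) (use M I xy0 in auto)
    show "((\<lambda>t. \<Sum>n. y n t) has_real_derivative c t * (\<Sum>n. x n t) + d t * (\<Sum>n. y n t)) (at t)"
      by (rule deriv_series[OF _ xyS(2) cont(3,4) _ _ sx(2)[OF I(3)] t]) (use M I xy0 in auto)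
  qed
qed

text \<open>Bootstrapping: the right-hand sides are as regular as the solution, so each step of the
  induction gains one derivative. The components are coupled and go through the induction
  together.\<close>

lemma smooth_on_linear_ode_2:
  fixes a b c d X Y :: "real \<Rightarrow> real"
  assumes "open S" and "smooth_on S a" "smooth_on S b" "smooth_on S c" "smooth_on S d"
    and X: "\<And>t. t \<in> S \<Longrightarrow> (X has_real_derivative a t * X t + b t * Y t) (at t)"
    and Y: "\<And>t. t \<in> S \<Longrightarrow> (Y has_real_derivative c t * X t + d t * Y t) (at t)"
  shows "smooth_on S X" "smooth_on S Y"
proof -
  have "Ck_on k S X \<and> Ck_on k S Y" for k
  proof (induction k)
    case 0
    have "continuous_on S X" "continuous_on S Y"
      by (rule DERIV_continuous_on, rule has_field_derivative_at_within, erule X Y)+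
    then show ?case by simp
  next
    case (Suc k)
    have "Ck_on k S (\<lambda>t. a t * X t + b t * Y t)" "Ck_on k S (\<lambda>t. c t * X t + d t * Y t)"
      by (intro Ck_on_add Ck_on_mult conjunct1[OF Suc] conjunct2[OF Suc] assms(1) smooth_onD assms(2-5))+
    then show ?case
      using Ck_on_Suc_real[OF assms(1) X] Ck_on_Suc_real[OF assms(1) Y] by simp
  qed
  then show "smooth_on S X" "smooth_on S Y" by (auto simp: smooth_on_def)
qed

text \<open>Bootstrapping again: the derivative of \<open>g\<close> is \<open>1 / r' (g u)\<close>,
  which is as regular as \<open>g\<close>.\<close>

lemma smooth_on_inverse_function_real:
  fixes r g :: "real \<Rightarrow> real"
  assumes "open (r ` J)" "smooth_on J r'" "\<And>t. t \<in> J \<Longrightarrow> r' t \<noteq> 0" "open J"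
    and g: "\<And>t. t \<in> J \<Longrightarrow> g (r t) = t"
    and g': "\<And>t. t \<in> J \<Longrightarrow> (g has_real_derivative 1 / r' t) (at (r t))"
  shows "smooth_on (r ` J) g"
proof (rule smooth_onI)
  have r1: "smooth_on J (\<lambda>t. 1 / r' t)"
    by (intro smooth_on_divide smooth_on_const assms)
  have der: "(g has_real_derivative 1 / r' (g u)) (at u)" if "u \<in> r ` J" for u
    using that g g' by auto
  show "Ck_on k (r ` J) g" for k
  proof (induction k)
    case 0
    have "continuous_on (r ` J) g"
      by (rule DERIV_continuous_on, rule has_field_derivative_at_within, rule der)
    then show ?case by simp
  next
    case (Suc k)
    have "Ck_on k (r ` J) (\<lambda>u. 1 / r' (g u))"
      by (rule Ck_on_compose[OF assms(1) Suc smooth_onD[OF r1]]) (use g in auto)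
    then show ?case using Ck_on_Suc_real[OF assms(1) der] by blast
  qed
qed

section \<open>Symmetry of mixed derivatives\<close>

text \<open>Both iterated derivatives are approximated by the same second difference, via the mean value
  theorem applied in either order.\<close>

lemma mixed_derivatives_real:
  fixes G :: "real \<Rightarrow> real \<Rightarrow> real"
  assumes e: "e > 0"
    and s: "\<And>s t. \<bar>s\<bar> < e \<Longrightarrow> \<bar>t\<bar> < e \<Longrightarrow> ((\<lambda>s. G s t) has_real_derivative Gs s t) (at s)"
    and st: "\<And>s t. \<bar>s\<bar> < e \<Longrightarrow> \<bar>t\<bar> < e \<Longrightarrow> ((\<lambda>t. Gs s t) has_real_derivative Gst s t) (at t)"
    and h: "0 < h" "h < e"
  obtains \<xi> \<eta> where "0 < \<xi>" "\<xi> < h" "0 < \<eta>" "\<eta> < h"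
    "G h h - G 0 h - G h 0 + G 0 0 = h * h * Gst \<xi> \<eta>"
proof -
  have "((\<lambda>s. G s h - G s 0) has_real_derivative Gs s h - Gs s 0) (at s)" if "0 \<le> s" "s \<le> h" for s
    using that h by (intro DERIV_diff s) auto
  then obtain \<xi> where x: "0 < \<xi>" "\<xi> < h" "(G h h - G h 0) - (G 0 h - G 0 0) = (h - 0) * (Gs \<xi> h - Gs \<xi> 0)"
    using MVT2[OF h(1), of "\<lambda>s. G s h - G s 0" "\<lambda>s. Gs s h - Gs s 0"] by blast
  have "((\<lambda>t. Gs \<xi> t) has_real_derivative Gst \<xi> t) (at t)" if "0 \<le> t" "t \<le> h" for t
    using that h x by (intro st) auto
  then obtain \<eta> where y: "0 < \<eta>" "\<eta> < h" "Gs \<xi> h - Gs \<xi> 0 = (h - 0) * Gst \<xi> \<eta>"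
    using MVT2[OF h(1), of "\<lambda>t. Gs \<xi> t" "\<lambda>t. Gst \<xi> t"] by blast
  show thesis
    by (rule that[OF x(1,2) y(1,2)]) (use x(3) y(3) in simp)
qed

lemma tendsto_small_square:
  fixes F :: "'a::real_normed_vector \<Rightarrow> real"
  assumes cont: "isCont F x" and e: "\<epsilon> > 0"
  obtains d where "d > 0" "\<And>\<xi> \<eta>. \<bar>\<xi>\<bar> < d \<Longrightarrow> \<bar>\<eta>\<bar> < d \<Longrightarrow> \<bar>F (x + \<xi> *\<^sub>R u + \<eta> *\<^sub>R v) - F x\<bar> < \<epsilon>"
proof -
  obtain r where r: "r > 0" "\<And>y. dist y x < r \<Longrightarrow> \<bar>F y - F x\<bar> < \<epsilon>"
    using cont e unfolding continuous_at_eps_delta dist_real_def by blast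
  \<comment> \<open>Adding 1 keeps the denominator positive when both directions vanish.\<close>
  define d where "d = r / (norm u + norm v + 1)"
  have D: "norm u + norm v + 1 > 0" by (simp add: add_nonneg_pos)
  show thesis
  proof
    show "d > 0" using r D by (simp add: d_def)
    fix \<xi> \<eta> :: real assume a: "\<bar>\<xi>\<bar> < d" "\<bar>\<eta>\<bar> < d"
    have "norm (\<xi> *\<^sub>R u + \<eta> *\<^sub>R v) \<le> \<bar>\<xi>\<bar> * norm u + \<bar>\<eta>\<bar> * norm v"
      by (metis norm_scaleR norm_triangle_ineq)
    also have "\<dots> \<le> d * norm u + d * norm v"
      using a by (intro add_mono mult_right_mono) auto
    also have "\<dots> < d * (norm u + norm v + 1)"
      using \<open>d > 0\<close> by (simp add: algebra_simps)
    also have "\<dots> = r" using D by (simp add: d_def)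
    finally show "\<bar>F (x + \<xi> *\<^sub>R u + \<eta> *\<^sub>R v) - F x\<bar> < \<epsilon>"
      by (intro r) (simp add: dist_norm add.assoc)
  qed
qed

lemma has_derivative_line:
  fixes F :: "'a::real_normed_vector \<Rightarrow> real"
  assumes "(F has_derivative F') (at (p + s *\<^sub>R v))"
  shows "((\<lambda>s. F (p + s *\<^sub>R v)) has_real_derivative F' v) (at s)"
proof -
  have "((\<lambda>s. p + s *\<^sub>R v) has_derivative (\<lambda>h. h *\<^sub>R v)) (at s)"
    by (auto intro!: derivative_eq_intros)
  from has_derivative_compose[OF this assms]
  have "((\<lambda>s. F (p + s *\<^sub>R v)) has_derivative (\<lambda>h. F' (h *\<^sub>R v))) (at s)" .
  moreover have "F' (h *\<^sub>R v) = F' v * h" for h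
    using linear_cmul[OF has_derivative_linear[OF assms]] by simp
  ultimately show ?thesis by (simp add: has_field_derivative_def)
qed

lemma symmetric_second_derivative_real:
  fixes F :: "'a::real_normed_vector \<Rightarrow> real"
  assumes S: "open S" "x \<in> S" and F: "smooth_on S F"
  shows "frechet_derivative (\<lambda>y. frechet_derivative F (at y) u) (at x) v =
         frechet_derivative (\<lambda>y. frechet_derivative F (at y) v) (at x) u"
proof -
  let ?D = "\<lambda>F v y. frechet_derivative F (at y) v"
  have close: "\<bar>?D (?D F u) v x - ?D (?D F v) u x\<bar> < 2 * \<epsilon>" if e: "\<epsilon> > 0" for \<epsilon>
  proof -
    have smooth2: "smooth_on S (?D (?D F a) b)" for a b
      by (intro smooth_on_frechet_derivative F)
    have "isCont (?D (?D F a) b) x" for a b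
      using smooth_on_imp_continuous_on[OF smooth2] S continuous_on_eq_continuous_at by blast
    from tendsto_small_square[OF this e] tendsto_small_square[OF this e]
    obtain d1 d2 where d1: "d1 > 0" "\<And>\<xi> \<eta>. \<bar>\<xi>\<bar> < d1 \<Longrightarrow> \<bar>\<eta>\<bar> < d1 \<Longrightarrow>
        \<bar>?D (?D F u) v (x + \<xi> *\<^sub>R u + \<eta> *\<^sub>R v) - ?D (?D F u) v x\<bar> < \<epsilon>"
      and d2: "d2 > 0" "\<And>\<xi> \<eta>. \<bar>\<xi>\<bar> < d2 \<Longrightarrow> \<bar>\<eta>\<bar> < d2 \<Longrightarrow>
        \<bar>?D (?D F v) u (x + \<xi> *\<^sub>R u + \<eta> *\<^sub>R v) - ?D (?D F v) u x\<bar> < \<epsilon>"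
      by metis
    obtain r where r: "r > 0" "ball x r \<subseteq> S" using S open_contains_ball by blast
    \<comment> \<open>The whole parallelogram has to lie in \<open>S\<close>. The distance to
      \<open>x\<close> is itself continuous, so \<open>tendsto_small_square\<close> also delivers
      this size.\<close>
    obtain d3 where d3: "d3 > 0" "\<And>s t. \<bar>s\<bar> < d3 \<Longrightarrow> \<bar>t\<bar> < d3 \<Longrightarrow> x + s *\<^sub>R u + t *\<^sub>R v \<in> S"
    proof -
      have "isCont (\<lambda>y. norm (y - x)) x" by (intro continuous_intros)
      from tendsto_small_square[OF this r(1), where u = u and v = v]
      obtain d where "d > 0" "\<And>s t. \<bar>s\<bar> < d \<Longrightarrow> \<bar>t\<bar> < d \<Longrightarrow> norm (x + s *\<^sub>R u + t *\<^sub>R v - x) < r"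
        by auto
      then show thesis
        using r(2) by (intro that[of d]) (auto simp: dist_norm norm_minus_commute subset_iff)
    qed
    define d where "d = min d1 (min d2 d3)"
    define h where "h = d / 2"
    have h: "0 < h" "h < d" "d > 0" using d1 d2 d3 by (auto simp: h_def d_def)
    let ?G = "\<lambda>s t. F (x + s *\<^sub>R u + t *\<^sub>R v)"
    have der1: "((\<lambda>s. f (x + s *\<^sub>R u + t *\<^sub>R v)) has_real_derivative ?D f u (x + s *\<^sub>R u + t *\<^sub>R v)) (at s)"
      if "smooth_on S f" "\<bar>s\<bar> < d" "\<bar>t\<bar> < d" for f :: "'a \<Rightarrow> real" and s t
      using has_derivative_line[of f _ "x + t *\<^sub>R v" s u] smooth_on_has_derivative[OF that(1) d3(2)[of s t]] that
      by (simp add: add_ac d_def)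
    have der2: "((\<lambda>t. f (x + s *\<^sub>R u + t *\<^sub>R v)) has_real_derivative ?D f v (x + s *\<^sub>R u + t *\<^sub>R v)) (at t)"
      if "smooth_on S f" "\<bar>s\<bar> < d" "\<bar>t\<bar> < d" for f :: "'a \<Rightarrow> real" and s t
      using has_derivative_line[of f _ "x + s *\<^sub>R u" t v] smooth_on_has_derivative[OF that(1) d3(2)[of s t]] that
      by (simp add: d_def)
    obtain \<xi> \<eta> where 1: "0 < \<xi>" "\<xi> < h" "0 < \<eta>" "\<eta> < h"
      "?G h h - ?G 0 h - ?G h 0 + ?G 0 0 = h * h * ?D (?D F u) v (x + \<xi> *\<^sub>R u + \<eta> *\<^sub>R v)"
      by (rule mixed_derivatives_real[where G = ?G and Gs = "\<lambda>s t. ?D F u (x + s *\<^sub>R u + t *\<^sub>R v)"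
            and Gst = "\<lambda>s t. ?D (?D F u) v (x + s *\<^sub>R u + t *\<^sub>R v)", OF h(3) der1[OF F] der2[OF smooth_on_frechet_derivative[OF F]] h(1,2)])
    \<comment> \<open>The same second difference with the parameters exchanged, which yields the
      derivative taken in the other order.\<close>
    obtain \<eta>' \<xi>' where 2: "0 < \<eta>'" "\<eta>' < h" "0 < \<xi>'" "\<xi>' < h"
      "?G h h - ?G h 0 - ?G 0 h + ?G 0 0 = h * h * ?D (?D F v) u (x + \<xi>' *\<^sub>R u + \<eta>' *\<^sub>R v)"
      by (rule mixed_derivatives_real[where G = "\<lambda>t s. ?G s t" and Gs = "\<lambda>t s. ?D F v (x + s *\<^sub>R u + t *\<^sub>R v)"
            and Gst = "\<lambda>t s. ?D (?D F v) u (x + s *\<^sub>R u + t *\<^sub>R v)", OF h(3) der2[OF F] der1[OF smooth_on_frechet_derivative[OF F]] h(1,2)])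
    have "h * h * ?D (?D F u) v (x + \<xi> *\<^sub>R u + \<eta> *\<^sub>R v) = h * h * ?D (?D F v) u (x + \<xi>' *\<^sub>R u + \<eta>' *\<^sub>R v)"
      using 1(5) 2(5) by linarith
    then have "?D (?D F u) v (x + \<xi> *\<^sub>R u + \<eta> *\<^sub>R v) = ?D (?D F v) u (x + \<xi>' *\<^sub>R u + \<eta>' *\<^sub>R v)"
      using h(1) by simp
    moreover have "\<bar>?D (?D F u) v (x + \<xi> *\<^sub>R u + \<eta> *\<^sub>R v) - ?D (?D F u) v x\<bar> < \<epsilon>"
      using 1 h by (intro d1) (auto simp: d_def)
    moreover have "\<bar>?D (?D F v) u (x + \<xi>' *\<^sub>R u + \<eta>' *\<^sub>R v) - ?D (?D F v) u x\<bar> < \<epsilon>"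
      using 2 h by (intro d2) (auto simp: d_def)
    ultimately show ?thesis by linarith
  qed
  show ?thesis
  proof (rule ccontr)
    assume "\<not> ?thesis"
    then have "\<bar>?D (?D F u) v x - ?D (?D F v) u x\<bar> / 2 > 0" by simp
    from close[OF this] show False by simp
  qed
qed

lemma frechet_derivative_linear_compose:
  assumes "bounded_linear L" "f differentiable (at x)"
  shows "frechet_derivative (\<lambda>y. L (f y)) (at x) h = L (frechet_derivative f (at x) h)"
proof -
  have "((\<lambda>y. L (f y)) has_derivative (\<lambda>h. L (frechet_derivative f (at x) h))) (at x)"
    using assms(2) by (intro bounded_linear.has_derivative[OF assms(1)]) (simp add: frechet_derivative_works)
  from frechet_derivative_at[OF this] show ?thesis by (simp only: fun_eq_iff)
qed

text \<open>Componentwise reduction: inner products with basis vectors commute with both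
  derivatives.\<close>

lemma symmetric_second_derivative:
  fixes F :: "'a::real_normed_vector \<Rightarrow> 'b::euclidean_space"
  assumes S: "open S" "x \<in> S" and F: "smooth_on S F"
  shows "frechet_derivative (\<lambda>y. frechet_derivative F (at y) u) (at x) v =
         frechet_derivative (\<lambda>y. frechet_derivative F (at y) v) (at x) u"
proof (rule euclidean_eqI)
  fix b :: 'b
  have D: "smooth_on S f \<Longrightarrow> y \<in> S \<Longrightarrow> frechet_derivative (\<lambda>z. f z \<bullet> b) (at y) h = frechet_derivative f (at y) h \<bullet> b"
    for f :: "'a \<Rightarrow> 'b" and y h
    using frechet_derivative_linear_compose[OF bounded_linear_inner_left, of f y b h]
      smooth_on_has_derivative[of S f y] by (auto simp: differentiable_def)
  have DD: "frechet_derivative (\<lambda>y. frechet_derivative F (at y) u) (at x) v \<bullet> b =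
      frechet_derivative (\<lambda>y. frechet_derivative (\<lambda>z. F z \<bullet> b) (at y) u) (at x) v" for u v
  proof -
    have "frechet_derivative (\<lambda>y. frechet_derivative F (at y) u) (at x) v \<bullet> b =
        frechet_derivative (\<lambda>y. frechet_derivative F (at y) u \<bullet> b) (at x) v"
      using D[OF smooth_on_frechet_derivative[OF F] S(2)] by simp
    also have "\<dots> = frechet_derivative (\<lambda>y. frechet_derivative (\<lambda>z. F z \<bullet> b) (at y) u) (at x) v"
      using frechet_derivative_transform_open[OF S, of "\<lambda>y. frechet_derivative F (at y) u \<bullet> b"
          "\<lambda>y. frechet_derivative (\<lambda>z. F z \<bullet> b) (at y) u"] D[OF F] by metis
    finally show ?thesis .
  qed
  have "smooth_on S (\<lambda>z. F z \<bullet> b)"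
    by (rule smooth_on_linear_compose[OF bounded_linear_inner_left S(1) F])
  from symmetric_second_derivative_real[OF S this, of u v]
  show "frechet_derivative (\<lambda>y. frechet_derivative F (at y) u) (at x) v \<bullet> b =
         frechet_derivative (\<lambda>y. frechet_derivative F (at y) v) (at x) u \<bullet> b"
    unfolding DD .
qed

section \<open>Necessity\<close>

lemma smooth_on_imp_twice_differentiable:
  assumes "open S" "smooth_on S f"
  shows "twice_differentiable_on S f"
  unfolding twice_differentiable_on_def
  using smooth_on_has_derivative[OF assms(2)] smooth_on_has_derivative[OF smooth_on_deriv[OF assms]]
  by (auto simp: differentiable_def)

lemma frechet_derivative_sum3:
  fixes f :: "real \<times> real \<times> real \<Rightarrow> 'b::real_normed_vector"
  assumes "f differentiable (at x)"
  shows "frechet_derivative f (at x) (a, b, c) = a *\<^sub>R frechet_derivative f (at x) (1, 0, 0) +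
    b *\<^sub>R frechet_derivative f (at x) (0, 1, 0) + c *\<^sub>R frechet_derivative f (at x) (0, 0, 1)"
proof -
  have "linear (frechet_derivative f (at x))"
    using assms has_derivative_linear frechet_derivative_works by blast
  moreover have "(a, b, c) = a *\<^sub>R (1, 0, 0) + b *\<^sub>R (0, 1, 0) + c *\<^sub>R (0::real, 0::real, 1::real)" by simp
  ultimately show ?thesis
    by (simp only: linear_add linear_cmul)
qed

lemma smooth_on_differentiable: "smooth_on S f \<Longrightarrow> x \<in> S \<Longrightarrow> f differentiable (at x)"
  using smooth_on_has_derivative by (auto simp: differentiable_def)

text \<open>The test curves are the preimages of straight lines, reparametrised by \<open>x\<close>; by hypothesis they
  solve \<open>P\<close>.\<close>

lemma maps_system_free_particle_second_order:
  fixes \<phi> :: "real \<times> real \<times> real \<Rightarrow> real \<times> real \<times> real" and p q :: real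
  assumes V: "open V" "smooth_on V \<phi>" "open (\<phi> ` V)" "smooth_on (\<phi> ` V) \<psi>"
    and inv: "\<And>X. X \<in> V \<Longrightarrow> \<psi> (\<phi> X) = X"
    and maps: "maps_system \<phi> V P free_particle"
    and X0: "(x0, y0, z0) \<in> V"
  defines "F \<equiv> \<lambda>e X. frechet_derivative \<phi> (at X) e"
  defines "a \<equiv> (1, p, q)"
  assumes d0: "fst (F a (x0, y0, z0)) \<noteq> 0"
  obtains y2 z2 \<mu> where "P x0 y0 z0 p q y2 z2"
    "frechet_derivative (F (1, 0, 0)) (at (x0, y0, z0)) a +
      p *\<^sub>R frechet_derivative (F (0, 1, 0)) (at (x0, y0, z0)) a +
      q *\<^sub>R frechet_derivative (F (0, 0, 1)) (at (x0, y0, z0)) a +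
      y2 *\<^sub>R F (0, 1, 0) (x0, y0, z0) + z2 *\<^sub>R F (0, 0, 1) (x0, y0, z0) = \<mu> *\<^sub>R F a (x0, y0, z0)"
proof -
  let ?X0 = "(x0, y0, z0)"
  \<comment> \<open>Velocity of the image line, chosen so that its preimage leaves the base point in
    the direction \<open>a\<close>.\<close>
  define d where "d = F a ?X0"
  define S where "S = (\<lambda>s::real. \<phi> ?X0 + s *\<^sub>R d) -` (\<phi> ` V)"
  define G where "G s = \<psi> (\<phi> ?X0 + s *\<^sub>R d)" for s :: real
  have S: "open S" "0 \<in> S"
    unfolding S_def using V(3) X0 by (auto intro!: open_vimage continuous_intros)
  have "smooth_on S (\<lambda>s. \<phi> ?X0 + s *\<^sub>R d)"
    by (intro smooth_intros S(1))
  then have G: "smooth_on S G"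
    unfolding G_def by (rule smooth_on_compose[OF S(1) V(4)]) (auto simp: S_def)
  have GV: "G s \<in> V" and \<phi>G: "\<phi> (G s) = \<phi> ?X0 + s *\<^sub>R d" if "s \<in> S" for s
  proof -
    from that obtain X where "X \<in> V" "\<phi> ?X0 + s *\<^sub>R d = \<phi> X" by (auto simp: S_def)
    then show "G s \<in> V" "\<phi> (G s) = \<phi> ?X0 + s *\<^sub>R d" by (simp_all add: G_def inv)
  qed
  define xs where "xs s = fst (G s)" for s
  define ys where "ys s = fst (snd (G s))" for s
  define zs where "zs s = snd (snd (G s))" for s
  have xyz: "smooth_on S xs" "smooth_on S ys" "smooth_on S zs"
    unfolding xs_def ys_def zs_def by (intro smooth_on_fst smooth_on_snd S G)+
  have G0: "G 0 = ?X0" by (simp add: G_def inv X0)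
  have G': "(G has_derivative (\<lambda>h. h *\<^sub>R a)) (at 0)"
  proof -
    have \<phi>': "(\<phi> has_derivative frechet_derivative \<phi> (at ?X0)) (at ?X0)"
      by (rule smooth_on_has_derivative[OF V(2) X0])
    have \<psi>': "(\<psi> has_derivative frechet_derivative \<psi> (at (\<phi> ?X0))) (at (\<phi> ?X0))"
      by (rule smooth_on_has_derivative[OF V(4)]) (use X0 in auto)
    have "((\<lambda>X. \<psi> (\<phi> X)) has_derivative (\<lambda>h. frechet_derivative \<psi> (at (\<phi> ?X0)) (frechet_derivative \<phi> (at ?X0) h))) (at ?X0)"
      by (rule has_derivative_compose[OF \<phi>' \<psi>'])
    moreover have "((\<lambda>X. \<psi> (\<phi> X)) has_derivative (\<lambda>h. h)) (at ?X0)"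
      by (rule has_derivative_transform_within_open[OF has_derivative_ident V(1) X0]) (simp add: inv)
    ultimately have "(\<lambda>h. frechet_derivative \<psi> (at (\<phi> ?X0)) (frechet_derivative \<phi> (at ?X0) h)) = (\<lambda>h. h)"
      by (rule has_derivative_unique)
    then have *: "frechet_derivative \<psi> (at (\<phi> ?X0)) d = a"
      unfolding d_def F_def by (rule fun_cong)
    have line: "((\<lambda>s. \<phi> ?X0 + s *\<^sub>R d) has_derivative (\<lambda>h. h *\<^sub>R d)) (at 0)"
      by (auto intro!: derivative_eq_intros)
    have "(G has_derivative (\<lambda>h. frechet_derivative \<psi> (at (\<phi> ?X0)) (h *\<^sub>R d))) (at 0)"
      unfolding G_def using has_derivative_compose[OF line, of \<psi>] \<psi>' by simp
    then show ?thesis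
      by (simp add: linear_cmul[OF has_derivative_linear[OF \<psi>']] *)
  qed
  have deriv0: "deriv xs 0 = 1" "deriv ys 0 = p" "deriv zs 0 = q"
  proof -
    have eq: "(\<lambda>h. h * c) = (*) c" for c :: real by (simp add: fun_eq_iff)
    have "(xs has_derivative (\<lambda>h. h * 1)) (at 0)" "(ys has_derivative (\<lambda>h. h * p)) (at 0)"
      "(zs has_derivative (\<lambda>h. h * q)) (at 0)"
      using has_derivative_fst[OF G'] has_derivative_fst[OF has_derivative_snd[OF G']]
        has_derivative_snd[OF has_derivative_snd[OF G']]
      unfolding xs_def ys_def zs_def a_def by simp_all
    then show "deriv xs 0 = 1" "deriv ys 0 = p" "deriv zs 0 = q"
      by (intro DERIV_imp_deriv; simp only: has_field_derivative_def eq)+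
  qed
  \<comment> \<open>\<open>xs\<close> has derivative 1 at 0, so it is increasing on a small interval
    and \<open>x\<close> can replace \<open>s\<close> as parameter.\<close>
  obtain \<epsilon> where e: "\<epsilon> > 0" "ball 0 \<epsilon> \<subseteq> S" "\<And>s. s \<in> ball 0 \<epsilon> \<Longrightarrow> deriv xs s > 0"
  proof -
    have "open (S \<inter> deriv xs -` {0<..})"
      by (rule continuous_open_preimage[OF smooth_on_imp_continuous_on[OF smooth_on_deriv[OF S(1) xyz(1)]] S(1)
            open_greaterThan])
    moreover have "0 \<in> S \<inter> deriv xs -` {0<..}"
      using S deriv0 by simp
    ultimately obtain \<epsilon> where "\<epsilon> > 0" "ball 0 \<epsilon> \<subseteq> S \<inter> deriv xs -` {0<..}"
      using open_contains_ball by blast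
    then show thesis by (intro that[of \<epsilon>]) auto
  qed
  let ?J = "ball (0::real) \<epsilon>"
  note xyzJ = xyz[THEN smooth_on_subset, OF e(2)]
  have Jint: "is_interval ?J" by (simp add: is_interval_ball_real)
  obtain g where g: "\<And>s. s \<in> ?J \<Longrightarrow> g (xs s) = s"
      "\<And>s. s \<in> ?J \<Longrightarrow> (g has_real_derivative 1 / deriv xs s) (at (xs s))"
      and I: "open (xs ` ?J)" "is_interval (xs ` ?J)"
    by (rule inverse_function_real[OF open_ball Jint smooth_on_has_real_derivative[OF xyzJ(1)] e(3)]) blast+
  have g_smooth: "smooth_on (xs ` ?J) g"
    by (rule smooth_on_inverse_function_real[OF I(1) smooth_on_deriv[OF open_ball xyzJ(1)] _ open_ball g(1,2)])
      (use e(3) in force)+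
  define I where "I = xs ` ?J"
  have gI: "g t \<in> ?J" "xs (g t) = t" "(g has_real_derivative 1 / deriv xs (g t)) (at t)" if "t \<in> I" for t
    using that g unfolding I_def by auto
  have g': "deriv g t = 1 / deriv xs (g t)" if "t \<in> I" for t
    using gI(3)[OF that] by (rule DERIV_imp_deriv)
  define y where "y t = ys (g t)" for t
  define z where "z t = zs (g t)" for t
  have yz: "smooth_on I y" "smooth_on I z"
    unfolding y_def z_def I_def
    by (rule smooth_on_compose[OF I(1) xyzJ(2) g_smooth] smooth_on_compose[OF I(1) xyzJ(3) g_smooth];
        use gI(1) I_def in blast)+
  have curve: "(t, y t, z t) = G (g t)" "(t, y t, z t) \<in> V"
    "\<phi> (t, y t, z t) = \<phi> ?X0 + g t *\<^sub>R d" if "t \<in> I" for t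
  proof -
    show *: "(t, y t, z t) = G (g t)"
      using gI(2)[OF that] by (simp add: y_def z_def xs_def ys_def zs_def prod_eq_iff)
    have "g t \<in> S" using gI(1)[OF that] e(2) by blast
    then show "(t, y t, z t) \<in> V" "\<phi> (t, y t, z t) = \<phi> ?X0 + g t *\<^sub>R d"
      unfolding * by (rule GV, rule \<phi>G)
  qed
  have x0: "x0 \<in> I" "g x0 = 0" "y x0 = y0" "z x0 = z0"
  proof -
    have "xs 0 = x0" by (simp add: xs_def G0)
    then show "x0 \<in> I" "g x0 = 0" using g(1)[of 0] e(1) by (auto simp: I_def)
    then show "y x0 = y0" "z x0 = z0" by (simp_all add: y_def z_def ys_def zs_def G0)
  qed
  have yz0: "deriv y x0 = p" "deriv z x0 = q"
  proof -
    have gx0: "(g has_real_derivative 1) (at x0)"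
      using gI(3)[OF x0(1)] by (simp add: x0 deriv0)
    have "0 \<in> ?J" using e by simp
    then have "(ys has_real_derivative p) (at (g x0))" "(zs has_real_derivative q) (at (g x0))"
      using smooth_on_has_real_derivative[OF xyzJ(2)] smooth_on_has_real_derivative[OF xyzJ(3)] deriv0 x0
      by metis+
    from DERIV_chain2[OF this(1) gx0] DERIV_chain2[OF this(2) gx0]
    show "deriv y x0 = p" "deriv z x0 = q" unfolding y_def z_def
      by (auto intro!: DERIV_imp_deriv)
  qed
  define u where "u = (\<lambda>t. fst (\<phi> (t, y t, z t)))"
  have u: "u t = fst (\<phi> ?X0) + g t * fst d" if "t \<in> I" for t
    using curve(3)[OF that] by (simp add: u_def)
  have du: "fst d \<noteq> 0" using d0 by (simp add: d_def)
  have u': "deriv u t \<noteq> 0" if "t \<in> I" for t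
  proof -
    have "((\<lambda>t. fst (\<phi> ?X0) + g t * fst d) has_real_derivative (1 / deriv xs (g t)) * fst d) (at t)"
      by (auto intro!: derivative_eq_intros gI(3)[OF that])
    then have "(u has_real_derivative (1 / deriv xs (g t)) * fst d) (at t)"
      by (rule has_field_derivative_transform_within_open[OF _ I(1)[folded I_def] that]) (simp add: u)
    then show ?thesis
      using DERIV_imp_deriv du e(3)[OF gI(1)[OF that]] by fastforce
  qed
  \<comment> \<open>The image line written as a graph over \<open>u\<close>; the slopes make sense
    because \<open>fst d\<close> is nonzero by \<open>d0\<close>.\<close>
  define \<eta> where "\<eta> t = fst (snd (\<phi> ?X0)) + (t - fst (\<phi> ?X0)) * (fst (snd d) / fst d)" for t
  define \<zeta> where "\<zeta> t = snd (snd (\<phi> ?X0)) + (t - fst (\<phi> ?X0)) * (snd (snd d) / fst d)" for t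
  have affine: "f differentiable (at t)" "deriv f = (\<lambda>_. c2)"
    if "\<And>t. f t = c0 + (t - c1) * c2" for f c0 c1 c2 and t :: real
  proof -
    have "f = (\<lambda>t. c0 + (t - c1) * c2)" using that by (rule ext)
    then have *: "(f has_real_derivative c2) (at t)" for t
      by (auto intro!: derivative_eq_intros)
    then show "f differentiable (at t)" "deriv f = (\<lambda>_. c2)"
      by (auto intro!: DERIV_imp_deriv simp: real_differentiable_def)
  qed
  have "solves free_particle (u ` I) \<eta> \<zeta>"
    unfolding solves_def twice_differentiable_on_def free_particle_def
    using affine[OF \<eta>_def] affine[OF \<zeta>_def] by simp
  moreover have "\<phi> (t, y t, z t) = (u t, \<eta> (u t), \<zeta> (u t))" if "t \<in> I" for t
    using curve(3)[OF that] u[OF that] du by (simp add: \<eta>_def \<zeta>_def prod_eq_iff)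
  moreover have "open I" "is_interval I" "twice_differentiable_on I y" "twice_differentiable_on I z"
    using I smooth_on_imp_twice_differentiable yz by (auto simp: I_def)
  ultimately have "solves P I y z"
    using maps curve(2) u' unfolding maps_system_def Let_def u_def by blast
  then have P: "P x0 y0 z0 p q (deriv (deriv y) x0) (deriv (deriv z) x0)"
    using x0 yz0 unfolding solves_def by metis
  have c': "((\<lambda>t. (t, y t, z t)) has_derivative (\<lambda>h. h *\<^sub>R (1, deriv y t, deriv z t))) (at t)"
    if "t \<in> I" for t
    using smooth_on_has_real_derivative[OF yz(1) that] smooth_on_has_real_derivative[OF yz(2) that]
    unfolding has_field_derivative_def
    by (auto intro!: derivative_eq_intros simp: mult.commute)
  have openI: "open I" using I by (simp add: I_def)
  \<comment> \<open>The image runs along a straight line with parameter \<open>g t\<close>, so its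
    velocity is a multiple of the fixed vector \<open>d\<close>. Differentiating this identity at
    \<open>x0\<close> gives the claim, with \<open>\<mu>\<close> the second derivative of
    \<open>g\<close>, since \<open>d\<close> is \<open>F a\<close> at the base point.\<close>
  have first: "F (1, 0, 0) (t, y t, z t) + deriv y t *\<^sub>R F (0, 1, 0) (t, y t, z t)
      + deriv z t *\<^sub>R F (0, 0, 1) (t, y t, z t) = deriv g t *\<^sub>R d" if t: "t \<in> I" for t
  proof -
    note D = smooth_on_has_derivative[OF V(2) curve(2)[OF t]]
    have 1: "((\<lambda>t. \<phi> (t, y t, z t)) has_derivative
        (\<lambda>h. frechet_derivative \<phi> (at (t, y t, z t)) (h *\<^sub>R (1, deriv y t, deriv z t)))) (at t)"
      by (rule has_derivative_compose[OF c'[OF t] D])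
    have "((\<lambda>t. \<phi> ?X0 + g t *\<^sub>R d) has_derivative (\<lambda>h. (deriv g t * h) *\<^sub>R d)) (at t)"
      using has_derivative_add[OF has_derivative_const has_derivative_scaleR_left
          [OF gI(3)[OF t, unfolded g'[OF t, symmetric] has_field_derivative_def]]]
      by simp
    then have 2: "((\<lambda>t. \<phi> (t, y t, z t)) has_derivative (\<lambda>h. (deriv g t * h) *\<^sub>R d)) (at t)"
      by (rule has_derivative_transform_within_open[OF _ openI t]) (simp add: curve(3))
    have "frechet_derivative \<phi> (at (t, y t, z t)) (1 *\<^sub>R (1, deriv y t, deriv z t)) = (deriv g t * 1) *\<^sub>R d"
      using has_derivative_unique[OF 1 2] by (rule fun_cong)
    then show ?thesis
      using frechet_derivative_sum3[OF smooth_on_differentiable[OF V(2) curve(2)[OF t]],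
          of 1 "deriv y t" "deriv z t"]
      by (simp add: F_def)
  qed
  have Fsmooth: "smooth_on V (F e)" for e
    unfolding F_def by (rule smooth_on_frechet_derivative[OF V(2)])
  have Fc: "((\<lambda>t. F e (t, y t, z t)) has_derivative (\<lambda>h. h *\<^sub>R frechet_derivative (F e) (at ?X0) a)) (at x0)" for e
  proof -
    have D: "(F e has_derivative frechet_derivative (F e) (at (x0, y x0, z x0))) (at (x0, y x0, z x0))"
      using smooth_on_has_derivative[OF Fsmooth] X0 x0 by simp
    show ?thesis
      using has_derivative_compose[OF c'[OF x0(1)] D]
      by (simp only: linear_cmul[OF has_derivative_linear[OF D]]) (simp only: x0 yz0 a_def)
  qed
  have y'': "(deriv y has_derivative (\<lambda>h. deriv (deriv y) x0 * h)) (at x0)"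
    "(deriv z has_derivative (\<lambda>h. deriv (deriv z) x0 * h)) (at x0)"
    "(deriv g has_derivative (\<lambda>h. deriv (deriv g) x0 * h)) (at x0)"
    using smooth_on_has_real_derivative[OF smooth_on_deriv[OF openI] x0(1)] yz g_smooth
    unfolding has_field_derivative_def I_def by blast+
  have 1: "((\<lambda>t. F (1, 0, 0) (t, y t, z t) + deriv y t *\<^sub>R F (0, 1, 0) (t, y t, z t)
      + deriv z t *\<^sub>R F (0, 0, 1) (t, y t, z t)) has_derivative (\<lambda>h.
      h *\<^sub>R frechet_derivative (F (1, 0, 0)) (at ?X0) a +
      (deriv y x0 *\<^sub>R (h *\<^sub>R frechet_derivative (F (0, 1, 0)) (at ?X0) a)
        + (deriv (deriv y) x0 * h) *\<^sub>R F (0, 1, 0) (x0, y x0, z x0)) +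
      (deriv z x0 *\<^sub>R (h *\<^sub>R frechet_derivative (F (0, 0, 1)) (at ?X0) a)
        + (deriv (deriv z) x0 * h) *\<^sub>R F (0, 0, 1) (x0, y x0, z x0)))) (at x0)"
    by (intro has_derivative_add has_derivative_scaleR Fc y'')
  have "((\<lambda>t. deriv g t *\<^sub>R d) has_derivative (\<lambda>h. (deriv (deriv g) x0 * h) *\<^sub>R d)) (at x0)"
    by (intro has_derivative_scaleR_left y'')
  then have 2: "((\<lambda>t. F (1, 0, 0) (t, y t, z t) + deriv y t *\<^sub>R F (0, 1, 0) (t, y t, z t)
      + deriv z t *\<^sub>R F (0, 0, 1) (t, y t, z t)) has_derivative (\<lambda>h. (deriv (deriv g) x0 * h) *\<^sub>R d)) (at x0)"
    by (rule has_derivative_transform_within_open[OF _ openI x0(1)]) (simp add: first)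
  from fun_cong[OF has_derivative_unique[OF 1 2], of 1]
  show thesis
    by (intro that[OF P, of "deriv (deriv g) x0"]) (simp add: x0 yz0 d_def algebra_simps)
qed

section \<open>Polynomial identities in the direction\<close>

text \<open>Directions with \<open>du/dt = 0\<close> are excluded in \<open>maps_system\<close>;
  they form a line in the \<open>(p, q)\<close> plane or the empty set. From a point of that line
  the normal direction \<open>(l2, l3)\<close> leads off it at once, and continuity carries the zero
  back.\<close>

lemma zero_off_line_imp_zero:
  fixes h :: "real \<Rightarrow> real \<Rightarrow> real"
  assumes l: "(l1, l2, l3) \<noteq> (0, 0, 0)"
    and cont: "\<And>p q a b. isCont (\<lambda>t. h (p + t * a) (q + t * b)) 0"
    and zero: "\<And>p q. l1 + l2 * p + l3 * q \<noteq> 0 \<Longrightarrow> h p q = 0"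
  shows "h p q = 0"
proof (cases "l1 + l2 * p + l3 * q = 0")
  case True
  have nz: "h (p + t * l2) (q + t * l3) = 0" if "t \<noteq> 0" for t
  proof (rule zero)
    \<comment> \<open>With \<open>l2 = l3 = 0\<close> a point on the line would force
      \<open>l1 = 0\<close> as well.\<close>
    have "l2\<^sup>2 + l3\<^sup>2 \<noteq> 0"
      using l True by (auto simp: sum_power2_eq_zero_iff)
    moreover have "l1 + l2 * (p + t * l2) + l3 * (q + t * l3) = t * (l2\<^sup>2 + l3\<^sup>2)"
      using True by (simp add: power2_eq_square algebra_simps)
    ultimately show "l1 + l2 * (p + t * l2) + l3 * (q + t * l3) \<noteq> 0"
      using that by simp
  qed
  have "((\<lambda>t. h (p + t * l2) (q + t * l3)) \<longlongrightarrow> h p q) (at 0)"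
    using cont[of p l2 q l3] by (simp add: isCont_def)
  moreover have "((\<lambda>t. h (p + t * l2) (q + t * l3)) \<longlongrightarrow> 0) (at 0)"
    by (rule Lim_transform_eventually[OF tendsto_const]) (simp add: eventually_at_filter nz)
  ultimately show ?thesis by (rule LIM_unique)
qed (rule zero)

text \<open>The cubic part is \<open>p\<close> times a quadratic form, hence no \<open>q^3\<close>.
  Nine sample points determine the nine coefficients.\<close>

lemma cubic_zero_imp_coefficients_zero:
  fixes c0 c1 c2 c3 c4 c5 c6 c7 c8 :: real
  assumes "\<And>p q. c0 + c1 * p + c2 * q + c3 * p\<^sup>2 + c4 * (p * q) + c5 * q\<^sup>2 + c6 * p^3 + c7 * (p\<^sup>2 * q) + c8 * (p * q\<^sup>2) = 0"
  shows "c0 = 0 \<and> c1 = 0 \<and> c2 = 0 \<and> c3 = 0 \<and> c4 = 0 \<and> c5 = 0 \<and> c6 = 0 \<and> c7 = 0 \<and> c8 = 0"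
proof -
  have c0: "c0 = 0" using assms[of 0 0] by simp
  have "c1 = 0 \<and> c3 = 0 \<and> c6 = 0"
    using assms[of 1 0] assms[of "-1" 0] assms[of 2 0] c0 by simp
  moreover have "c2 = 0 \<and> c5 = 0"
    using assms[of 0 1] assms[of 0 "-1"] c0 by simp
  moreover have "c4 = 0 \<and> c7 = 0 \<and> c8 = 0"
    using assms[of 1 1] assms[of 1 "-1"] assms[of "-1" 1] calculation c0 by simp
  ultimately show ?thesis using c0 by blast
qed

lemma frechet_derivative_combination3:
  fixes a b c :: "'a::real_normed_vector \<Rightarrow> real" and A B C :: "'a \<Rightarrow> 'b::real_normed_vector"
  assumes "a differentiable (at X)" "b differentiable (at X)" "c differentiable (at X)"
    and "A differentiable (at X)" "B differentiable (at X)" "C differentiable (at X)"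
  shows "frechet_derivative (\<lambda>X. a X *\<^sub>R A X + b X *\<^sub>R B X + c X *\<^sub>R C X) (at X) e =
    (frechet_derivative a (at X) e *\<^sub>R A X + frechet_derivative b (at X) e *\<^sub>R B X + frechet_derivative c (at X) e *\<^sub>R C X) +
    (a X *\<^sub>R frechet_derivative A (at X) e + b X *\<^sub>R frechet_derivative B (at X) e + c X *\<^sub>R frechet_derivative C (at X) e)"
proof -
  note D = assms[unfolded frechet_derivative_works]
  have "((\<lambda>X. a X *\<^sub>R A X + b X *\<^sub>R B X + c X *\<^sub>R C X) has_derivative (\<lambda>e.
    (a X *\<^sub>R frechet_derivative A (at X) e + frechet_derivative a (at X) e *\<^sub>R A X) +
    (b X *\<^sub>R frechet_derivative B (at X) e + frechet_derivative b (at X) e *\<^sub>R B X) +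
    (c X *\<^sub>R frechet_derivative C (at X) e + frechet_derivative c (at X) e *\<^sub>R C X))) (at X)"
    by (intro has_derivative_add has_derivative_scaleR D)
  from fun_cong[OF frechet_derivative_at[OF this], of e, symmetric] show ?thesis
    by (simp add: algebra_simps)
qed

section \<open>Partial derivatives as values of the Frechet derivative\<close>

lemma has_real_derivative_partial_y:
  assumes "f differentiable (at (x, y, z))"
  shows "((\<lambda>s. f (x, s, z)) has_real_derivative frechet_derivative f (at (x, y, z)) (0, 1, 0)) (at y)"
proof -
  have "(f has_derivative frechet_derivative f (at (x, y, z))) (at ((x, y, z) + 0 *\<^sub>R (0, 1, 0)))"
    using assms by (simp add: frechet_derivative_works zero_prod_def)
  from has_derivative_line[OF this]
  have "((\<lambda>s. f (x, y + s, z)) has_real_derivative frechet_derivative f (at (x, y, z)) (0, 1, 0)) (at 0)"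
    by simp
  then show ?thesis
    using DERIV_shift[of "\<lambda>s. f (x, s, z)" _ 0 y] by (simp add: add.commute)
qed

lemma partial_y_eq_frechet:
  assumes "f differentiable (at (x, y, z))"
  shows "partial_y f (x, y, z) = frechet_derivative f (at (x, y, z)) (0, 1, 0)"
  unfolding partial_y_def using DERIV_imp_deriv[OF has_real_derivative_partial_y[OF assms]] by simp

lemma has_real_derivative_partial_z:
  assumes "f differentiable (at (x, y, z))"
  shows "((\<lambda>s. f (x, y, s)) has_real_derivative frechet_derivative f (at (x, y, z)) (0, 0, 1)) (at z)"
proof -
  have "(f has_derivative frechet_derivative f (at (x, y, z))) (at ((x, y, z) + 0 *\<^sub>R (0, 0, 1)))"
    using assms by (simp add: frechet_derivative_works zero_prod_def)
  from has_derivative_line[OF this]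
  have "((\<lambda>s. f (x, y, z + s)) has_real_derivative frechet_derivative f (at (x, y, z)) (0, 0, 1)) (at 0)"
    by simp
  then show ?thesis
    using DERIV_shift[of "\<lambda>s. f (x, y, s)" _ 0 z] by (simp add: add.commute)
qed

lemma partial_z_eq_frechet:
  assumes "f differentiable (at (x, y, z))"
  shows "partial_z f (x, y, z) = frechet_derivative f (at (x, y, z)) (0, 0, 1)"
  unfolding partial_z_def using DERIV_imp_deriv[OF has_real_derivative_partial_z[OF assms]] by simp

lemma has_derivative_fst_function:
  fixes f :: "real \<Rightarrow> real" and X :: "real \<times> 'a::real_normed_vector"
  assumes "(f has_real_derivative f') (at (fst X))"
  shows "((\<lambda>X. f (fst X)) has_derivative (\<lambda>h. f' * fst h)) (at X)"
  using has_derivative_compose[OF has_derivative_fst[OF has_derivative_ident] assms[unfolded has_field_derivative_def]] .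

section \<open>The flat connection pulled back by a linearizing map\<close>

locale linearizing_map =
  fixes V :: "(real \<times> real \<times> real) set" and \<phi> \<psi> :: "real \<times> real \<times> real \<Rightarrow> real \<times> real \<times> real"
    and C22 C23 C32 C33 :: "real \<Rightarrow> real" and D2 D3 :: "real \<times> real \<times> real \<Rightarrow> real"
  assumes openV: "open V" and smooth_\<phi>: "smooth_on V \<phi>"
    and open_image: "open (\<phi> ` V)" and smooth_\<psi>: "smooth_on (\<phi> ` V) \<psi>"
    and inv: "\<And>X. X \<in> V \<Longrightarrow> \<psi> (\<phi> X) = X"
    and maps: "maps_system \<phi> V (linear_in_first_derivatives C22 C23 C32 C33 D2 D3) free_particle"
    and smooth_C: "smooth_on (fst ` V) C22" "smooth_on (fst ` V) C23"
      "smooth_on (fst ` V) C32" "smooth_on (fst ` V) C33"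
    and smooth_D: "smooth_on V D2" "smooth_on V D3"
begin

definition F :: "real \<times> real \<times> real \<Rightarrow> real \<times> real \<times> real \<Rightarrow> real \<times> real \<times> real"
  where "F e X = frechet_derivative \<phi> (at X) e"

definition H :: "real \<times> real \<times> real \<Rightarrow> real \<times> real \<times> real \<Rightarrow> real \<times> real \<times> real \<Rightarrow> real \<times> real \<times> real"
  where "H e e' X = frechet_derivative (F e) (at X) e'"

text \<open>The inverse of the Jacobian \<open>\<lambda>e. F e X\<close>, taken from
  \<open>\<psi>\<close> so that its smoothness in \<open>X\<close> follows by composition.\<close>

definition W :: "real \<times> real \<times> real \<Rightarrow> real \<times> real \<times> real \<Rightarrow> real \<times> real \<times> real"
  where "W X = frechet_derivative \<psi> (at (\<phi> X))"

text \<open>The Christoffel symbols of the flat connection that \<open>\<phi>\<close> pulls back.\<close>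

definition \<Gamma> :: "real \<times> real \<times> real \<Rightarrow> real \<times> real \<times> real \<Rightarrow> real \<times> real \<times> real \<Rightarrow> real \<times> real \<times> real"
  where "\<Gamma> e e' X = W X (H e e' X)"

abbreviation e1 :: "real \<times> real \<times> real" where "e1 \<equiv> (1, 0, 0)"
abbreviation e2 :: "real \<times> real \<times> real" where "e2 \<equiv> (0, 1, 0)"
abbreviation e3 :: "real \<times> real \<times> real" where "e3 \<equiv> (0, 0, 1)"

lemma smooth_F: "smooth_on V (F e)"
  unfolding F_def by (rule smooth_on_frechet_derivative[OF smooth_\<phi>])

lemma smooth_H: "smooth_on V (H e e')"
  unfolding H_def by (rule smooth_on_frechet_derivative[OF smooth_F])

lemma H_sym: "X \<in> V \<Longrightarrow> H e e' X = H e' e X"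
  unfolding H_def F_def by (rule symmetric_second_derivative[OF openV _ smooth_\<phi>])

lemma linear_W: "X \<in> V \<Longrightarrow> linear (W X)"
  unfolding W_def by (rule has_derivative_linear[OF smooth_on_has_derivative[OF smooth_\<psi>]]) auto

lemma W_F: assumes "X \<in> V" shows "W X (F e X) = e"
proof -
  have "((\<lambda>X. \<psi> (\<phi> X)) has_derivative (\<lambda>h. W X (F h X))) (at X)"
    unfolding W_def F_def using assms
    by (intro has_derivative_compose[OF smooth_on_has_derivative[OF smooth_\<phi>] smooth_on_has_derivative[OF smooth_\<psi>]]) auto
  moreover have "((\<lambda>X. \<psi> (\<phi> X)) has_derivative (\<lambda>h. h)) (at X)"
    by (rule has_derivative_transform_within_open[OF has_derivative_ident openV assms]) (simp add: inv)
  ultimately have "(\<lambda>h. W X (F h X)) = (\<lambda>h. h)" by (rule has_derivative_unique)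
  then show ?thesis by (rule fun_cong)
qed

lemma F_W: assumes "X \<in> V" shows "F (W X v) X = v"
proof -
  have "\<phi> (\<psi> Y) = Y" if "Y \<in> \<phi> ` V" for Y using that inv by auto
  then have 1: "((\<lambda>Y. \<phi> (\<psi> Y)) has_derivative (\<lambda>h. h)) (at (\<phi> X))"
    using assms by (intro has_derivative_transform_within_open[OF has_derivative_ident open_image]) auto
  have "(\<psi> has_derivative W X) (at (\<phi> X))"
    unfolding W_def using assms by (intro smooth_on_has_derivative[OF smooth_\<psi>]) auto
  moreover have "(\<phi> has_derivative (\<lambda>h. F h X)) (at (\<psi> (\<phi> X)))"
    unfolding F_def inv[OF assms] using assms by (intro smooth_on_has_derivative[OF smooth_\<phi>])
  ultimately have "((\<lambda>Y. \<phi> (\<psi> Y)) has_derivative (\<lambda>h. F (W X h) X)) (at (\<phi> X))"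
    by (rule has_derivative_compose)
  from fun_cong[OF has_derivative_unique[OF this 1]] show ?thesis .
qed

lemma F_expand:
  assumes "X \<in> V"
  shows "F (a, b, c) X = a *\<^sub>R F e1 X + b *\<^sub>R F e2 X + c *\<^sub>R F e3 X"
  unfolding F_def by (rule frechet_derivative_sum3[OF smooth_on_differentiable[OF smooth_\<phi> assms]])

lemma H_expand:
  assumes "X \<in> V"
  shows "H e (a, b, c) X = a *\<^sub>R H e e1 X + b *\<^sub>R H e e2 X + c *\<^sub>R H e e3 X"
  unfolding H_def by (rule frechet_derivative_sum3[OF smooth_on_differentiable[OF smooth_F assms]])

lemma smooth_\<Gamma>: "smooth_on V (\<Gamma> e e')"
proof -
  have W: "smooth_on V (\<lambda>X. W X v)" for v
    unfolding W_def
    by (rule smooth_on_compose[OF openV smooth_on_frechet_derivative[OF smooth_\<psi>] smooth_\<phi>]) auto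
  have "smooth_on V (\<lambda>X. fst (H e e' X) *\<^sub>R W X e1 + fst (snd (H e e' X)) *\<^sub>R W X e2 + snd (snd (H e e' X)) *\<^sub>R W X e3)"
    by (intro smooth_on_add smooth_on_scaleR smooth_on_fst smooth_on_snd smooth_H W openV)
  then show ?thesis
  proof (rule smooth_on_cong[OF openV])
    fix X assume X: "X \<in> V"
    have "\<psi> differentiable (at (\<phi> X))"
      using X by (intro smooth_on_differentiable[OF smooth_\<psi>]) auto
    from frechet_derivative_sum3[OF this, of "fst (H e e' X)" "fst (snd (H e e' X))" "snd (snd (H e e' X))"]
    show "fst (H e e' X) *\<^sub>R W X e1 + fst (snd (H e e' X)) *\<^sub>R W X e2 + snd (snd (H e e' X)) *\<^sub>R W X e3 = \<Gamma> e e' X"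
      by (simp add: \<Gamma>_def W_def)
  qed
qed

text \<open>The geodesic equation of \<open>\<Gamma>\<close> in direction \<open>(1, p, q)\<close>,
  obtained by applying \<open>W\<close> to the second-order identity along a test curve and
  eliminating \<open>y''\<close>, \<open>z''\<close> through the system. The multiple
  \<open>\<mu>\<close> remains because \<open>x\<close> need not be an affine parameter.\<close>

lemma second_order:
  assumes X: "(x, y, z) \<in> V" and nz: "fst (F (1, p, q) (x, y, z)) \<noteq> 0"
  defines "X \<equiv> (x, y, z)"
  shows "\<exists>\<mu>. \<Gamma> e1 e1 X + (2 * p) *\<^sub>R \<Gamma> e1 e2 X + (2 * q) *\<^sub>R \<Gamma> e1 e3 X +
    p\<^sup>2 *\<^sub>R \<Gamma> e2 e2 X + (2 * (p * q)) *\<^sub>R \<Gamma> e2 e3 X + q\<^sup>2 *\<^sub>R \<Gamma> e3 e3 X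
    = (\<mu>, \<mu> * p + C22 x * p + C23 x * q + D2 X, \<mu> * q + C32 x * p + C33 x * q + D3 X)"
proof -
  obtain y2 z2 \<mu> where P: "linear_in_first_derivatives C22 C23 C32 C33 D2 D3 x y z p q y2 z2"
    and eq: "H e1 (1, p, q) X + p *\<^sub>R H e2 (1, p, q) X + q *\<^sub>R H e3 (1, p, q) X +
      y2 *\<^sub>R F e2 X + z2 *\<^sub>R F e3 X = \<mu> *\<^sub>R F (1, p, q) X"
    using maps_system_free_particle_second_order[OF openV smooth_\<phi> open_image smooth_\<psi> inv maps X, of p q]
      nz unfolding H_def F_def X_def by blast
  have XV: "X \<in> V" using X by (simp add: X_def)
  note expand = H_expand[OF XV, of _ 1 p q]
  note sym = H_sym[OF XV, of e2 e1] H_sym[OF XV, of e3 e1] H_sym[OF XV, of e3 e2]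
  note lin = linear_add[OF linear_W[OF XV]] linear_cmul[OF linear_W[OF XV]]
  have "W X (H e1 (1, p, q) X + p *\<^sub>R H e2 (1, p, q) X + q *\<^sub>R H e3 (1, p, q) X +
      y2 *\<^sub>R F e2 X + z2 *\<^sub>R F e3 X) = W X (\<mu> *\<^sub>R F (1, p, q) X)"
    using eq by simp
  then have "\<Gamma> e1 e1 X + (2 * p) *\<^sub>R \<Gamma> e1 e2 X + (2 * q) *\<^sub>R \<Gamma> e1 e3 X +
    p\<^sup>2 *\<^sub>R \<Gamma> e2 e2 X + (2 * (p * q)) *\<^sub>R \<Gamma> e2 e3 X + q\<^sup>2 *\<^sub>R \<Gamma> e3 e3 X = (\<mu>, \<mu> * p - y2, \<mu> * q - z2)"
    unfolding expand sym lin W_F[OF XV] \<Gamma>_def[symmetric]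
    by (simp add: prod_eq_iff power2_eq_square algebra_simps)
  moreover have "y2 = - (C22 x * p + C23 x * q + D2 X)" "z2 = - (C32 x * p + C33 x * q + D3 X)"
    using P by (simp_all add: linear_in_first_derivatives_def X_def)
  ultimately show ?thesis by (auto simp: algebra_simps)
qed

text \<open>The first component of \<open>second_order\<close> is \<open>\<mu>\<close>; inserting it
  in the other two gives two cubic identities in \<open>p, q\<close>. They leave exactly
  \<open>\<alpha>, \<beta>, \<gamma>\<close> open, which encode the one-form by which connections
  with the same unparametrised geodesics differ.\<close>

lemma \<Gamma>_coefficients:
  assumes X: "X \<in> V" and x: "x = fst X"
  defines "\<alpha> \<equiv> fst (\<Gamma> e1 e1 X)" and "\<beta> \<equiv> fst (\<Gamma> e1 e2 X)" and "\<gamma> \<equiv> fst (\<Gamma> e1 e3 X)"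
  shows "\<Gamma> e1 e1 X = (\<alpha>, D2 X, D3 X)"
    and "\<Gamma> e1 e2 X = (\<beta>, (C22 x + \<alpha>) / 2, C32 x / 2)"
    and "\<Gamma> e1 e3 X = (\<gamma>, C23 x / 2, (C33 x + \<alpha>) / 2)"
    and "\<Gamma> e2 e2 X = (0, 2 * \<beta>, 0)"
    and "\<Gamma> e2 e3 X = (0, \<gamma>, \<beta>)"
    and "\<Gamma> e3 e3 X = (0, 0, 2 * \<gamma>)"
proof -
  obtain y z where Xe: "X = (x, y, z)" using x by (metis prod.collapse)
  define Q where "Q k p q = k (\<Gamma> e1 e1 X) + (2 * p) * k (\<Gamma> e1 e2 X) + (2 * q) * k (\<Gamma> e1 e3 X) +
    p\<^sup>2 * k (\<Gamma> e2 e2 X) + (2 * (p * q)) * k (\<Gamma> e2 e3 X) + q\<^sup>2 * k (\<Gamma> e3 e3 X)"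
    for k :: "real \<times> real \<times> real \<Rightarrow> real" and p q
  define hy where "hy p q = Q (\<lambda>v. fst (snd v)) p q - Q fst p q * p - C22 x * p - C23 x * q - D2 X" for p q
  define hz where "hz p q = Q (\<lambda>v. snd (snd v)) p q - Q fst p q * q - C32 x * p - C33 x * q - D3 X" for p q
  have zero: "hy p q = 0 \<and> hz p q = 0" if nz: "fst (F (1, p, q) X) \<noteq> 0" for p q
  proof -
    obtain \<mu> where \<mu>: "\<Gamma> e1 e1 X + (2 * p) *\<^sub>R \<Gamma> e1 e2 X + (2 * q) *\<^sub>R \<Gamma> e1 e3 X +
      p\<^sup>2 *\<^sub>R \<Gamma> e2 e2 X + (2 * (p * q)) *\<^sub>R \<Gamma> e2 e3 X + q\<^sup>2 *\<^sub>R \<Gamma> e3 e3 X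
      = (\<mu>, \<mu> * p + C22 x * p + C23 x * q + D2 X, \<mu> * q + C32 x * p + C33 x * q + D3 X)"
      using second_order[of x y z p q] X nz Xe by blast
    have "Q fst p q = \<mu>" using arg_cong[OF \<mu>, of fst] by (simp add: Q_def)
    moreover have "Q (\<lambda>v. fst (snd v)) p q = \<mu> * p + C22 x * p + C23 x * q + D2 X"
      using arg_cong[OF \<mu>, of "\<lambda>v. fst (snd v)"] by (simp add: Q_def)
    moreover have "Q (\<lambda>v. snd (snd v)) p q = \<mu> * q + C32 x * p + C33 x * q + D3 X"
      using arg_cong[OF \<mu>, of "\<lambda>v. snd (snd v)"] by (simp add: Q_def)
    ultimately show ?thesis by (simp add: hy_def hz_def)
  qed
  \<comment> \<open>\<open>F_W\<close> makes the Jacobian surjective, so \<open>u\<close> has a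
    nonzero gradient.\<close>
  have nonzero: "(fst (F e1 X), fst (F e2 X), fst (F e3 X)) \<noteq> (0, 0, 0)"
  proof
    assume *: "(fst (F e1 X), fst (F e2 X), fst (F e3 X)) = (0, 0, 0)"
    obtain a b c where abc: "W X e1 = (a, b, c)" by (metis prod.collapse)
    have "fst (F (W X e1) X) = 0"
      unfolding abc F_expand[OF X, of a b c] using * by simp
    then show False using F_W[OF X] by simp
  qed
  have line: "fst (F e1 X) + fst (F e2 X) * p + fst (F e3 X) * q = fst (F (1, p, q) X)" for p q
    unfolding F_expand[OF X, of 1 p q] by simp
  have "hy p q = 0" for p q
  proof (rule zero_off_line_imp_zero[where h = hy, OF nonzero])
    show "isCont (\<lambda>t. hy (p + t * a) (q + t * b)) 0" for p q a b
      unfolding hy_def Q_def by (intro continuous_intros)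
  qed (simp add: line zero)
  then have "D2 X - fst (snd (\<Gamma> e1 e1 X)) + (C22 x + \<alpha> - 2 * fst (snd (\<Gamma> e1 e2 X))) * p
      + (C23 x - 2 * fst (snd (\<Gamma> e1 e3 X))) * q
      + (2 * \<beta> - fst (snd (\<Gamma> e2 e2 X))) * p\<^sup>2 + (2 * \<gamma> - 2 * fst (snd (\<Gamma> e2 e3 X))) * (p * q)
      + (- fst (snd (\<Gamma> e3 e3 X))) * q\<^sup>2
      + fst (\<Gamma> e2 e2 X) * p^3 + 2 * fst (\<Gamma> e2 e3 X) * (p\<^sup>2 * q) + fst (\<Gamma> e3 e3 X) * (p * q\<^sup>2) = 0" for p q
    unfolding hy_def Q_def \<alpha>_def \<beta>_def \<gamma>_def
    by (simp add: power2_eq_square power3_eq_cube algebra_simps)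
  note y = cubic_zero_imp_coefficients_zero[OF this]
  have "hz p q = 0" for p q
  proof (rule zero_off_line_imp_zero[where h = hz, OF nonzero])
    show "isCont (\<lambda>t. hz (p + t * a) (q + t * b)) 0" for p q a b
      unfolding hz_def Q_def by (intro continuous_intros)
  qed (simp add: line zero)
  \<comment> \<open>Arranged with \<open>q\<close> in the role of \<open>p\<close>, since here the
    cubic part is divisible by \<open>q\<close>.\<close>
  then have "D3 X - snd (snd (\<Gamma> e1 e1 X)) + (C33 x + \<alpha> - 2 * snd (snd (\<Gamma> e1 e3 X))) * q
      + (C32 x - 2 * snd (snd (\<Gamma> e1 e2 X))) * p
      + (2 * \<gamma> - snd (snd (\<Gamma> e3 e3 X))) * q\<^sup>2 + (2 * \<beta> - 2 * snd (snd (\<Gamma> e2 e3 X))) * (q * p)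
      + (- snd (snd (\<Gamma> e2 e2 X))) * p\<^sup>2
      + fst (\<Gamma> e3 e3 X) * q^3 + 2 * fst (\<Gamma> e2 e3 X) * (q\<^sup>2 * p) + fst (\<Gamma> e2 e2 X) * (q * p\<^sup>2) = 0" for p q
    unfolding hz_def Q_def \<alpha>_def \<beta>_def \<gamma>_def
    by (simp add: power2_eq_square power3_eq_cube algebra_simps)
  note z = cubic_zero_imp_coefficients_zero[OF this]
  from y z show "\<Gamma> e1 e1 X = (\<alpha>, D2 X, D3 X)"
    "\<Gamma> e1 e2 X = (\<beta>, (C22 x + \<alpha>) / 2, C32 x / 2)"
    "\<Gamma> e1 e3 X = (\<gamma>, C23 x / 2, (C33 x + \<alpha>) / 2)"
    "\<Gamma> e2 e2 X = (0, 2 * \<beta>, 0)" "\<Gamma> e2 e3 X = (0, \<gamma>, \<beta>)" "\<Gamma> e3 e3 X = (0, 0, 2 * \<gamma>)"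
    by (simp_all add: prod_eq_iff \<alpha>_def \<beta>_def \<gamma>_def)
qed

lemma H_combination:
  assumes "X \<in> V" "\<Gamma> e e' X = (a, b, c)"
  shows "H e e' X = a *\<^sub>R F e1 X + b *\<^sub>R F e2 X + c *\<^sub>R F e3 X"
  using F_W[OF assms(1), of "H e e' X"] F_expand[OF assms(1), of a b c] assms(2) by (simp add: \<Gamma>_def)

text \<open>Differentiate \<open>H e1 e = a F e1 + b F e2 + c F e3\<close> and pull back with
  \<open>W\<close>. Antisymmetrising such expressions in \<open>e\<close>, \<open>e'\<close> gives
  the curvature of the connection.\<close>

lemma W_third_derivative:
  assumes X: "X \<in> V"
    and \<Gamma>: "\<And>X. X \<in> V \<Longrightarrow> \<Gamma> e1 e X = (a X, b X, c X)"
    and abc: "a differentiable (at X)" "b differentiable (at X)" "c differentiable (at X)"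
  shows "W X (frechet_derivative (H e1 e) (at X) e') =
    (frechet_derivative a (at X) e', frechet_derivative b (at X) e', frechet_derivative c (at X) e') +
    (a X *\<^sub>R \<Gamma> e1 e' X + b X *\<^sub>R \<Gamma> e2 e' X + c X *\<^sub>R \<Gamma> e3 e' X)"
proof -
  have "frechet_derivative (H e1 e) (at X) =
    frechet_derivative (\<lambda>X. a X *\<^sub>R F e1 X + b X *\<^sub>R F e2 X + c X *\<^sub>R F e3 X) (at X)"
    by (rule frechet_derivative_transform_open[OF openV X H_combination[OF _ \<Gamma>]])
  then have *: "frechet_derivative (H e1 e) (at X) e' =
    (frechet_derivative a (at X) e' *\<^sub>R F e1 X + frechet_derivative b (at X) e' *\<^sub>R F e2 X + frechet_derivative c (at X) e' *\<^sub>R F e3 X) +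
    (a X *\<^sub>R H e1 e' X + b X *\<^sub>R H e2 e' X + c X *\<^sub>R H e3 e' X)"
    unfolding H_def using frechet_derivative_combination3[OF abc smooth_on_differentiable[OF smooth_F X]
      smooth_on_differentiable[OF smooth_F X] smooth_on_differentiable[OF smooth_F X]] by simp
  show ?thesis
    unfolding * linear_add[OF linear_W[OF X]] linear_cmul[OF linear_W[OF X]] W_F[OF X] \<Gamma>_def by simp
qed

text \<open>Third derivatives agree, xxy = xyx and xxz = xzx, that is, curvature vanishes. The first
  condition is the z-component of the former, the second the y-component of the latter, and the
  third the z-component of the latter minus the y-component of the former.\<close>

lemma conditions:
  assumes X: "(x, y, z) \<in> V"
  shows "1/2 * deriv C32 x + 1/4 * C33 x * C32 x + 1/4 * C22 x * C32 x = partial_y D3 (x, y, z)"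
    and "1/2 * deriv C23 x + 1/4 * C23 x * C33 x + 1/4 * C23 x * C22 x = partial_z D2 (x, y, z)"
    and "1/2 * deriv C33 x - 1/2 * deriv C22 x + 1/4 * C33 x * C33 x - 1/4 * C22 x * C22 x
         = partial_z D3 (x, y, z) - partial_y D2 (x, y, z)"
proof -
  let ?X = "(x, y, z)"
  define \<alpha> where "\<alpha> X = fst (\<Gamma> e1 e1 X)" for X
  define \<beta> where "\<beta> X = fst (\<Gamma> e1 e2 X)" for X
  define \<gamma> where "\<gamma> X = fst (\<Gamma> e1 e3 X)" for X
  note \<Gamma> = \<Gamma>_coefficients[OF _ refl, folded \<alpha>_def \<beta>_def \<gamma>_def]
  have \<alpha>\<beta>\<gamma>: "\<alpha> differentiable (at ?X)" "\<beta> differentiable (at ?X)" "\<gamma> differentiable (at ?X)"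
    unfolding \<alpha>_def \<beta>_def \<gamma>_def
    by (rule smooth_on_differentiable[OF smooth_on_fst[OF openV smooth_\<Gamma>] X])+
  have D: "D2 differentiable (at ?X)" "D3 differentiable (at ?X)"
    by (rule smooth_on_differentiable[OF smooth_D(1) X] smooth_on_differentiable[OF smooth_D(2) X])+
  have x: "x \<in> fst ` V" using X by force
  have C': "((\<lambda>X. C22 (fst X)) has_derivative (\<lambda>h. deriv C22 x * fst h)) (at ?X)"
    "((\<lambda>X. C23 (fst X)) has_derivative (\<lambda>h. deriv C23 x * fst h)) (at ?X)"
    "((\<lambda>X. C32 (fst X)) has_derivative (\<lambda>h. deriv C32 x * fst h)) (at ?X)"
    "((\<lambda>X. C33 (fst X)) has_derivative (\<lambda>h. deriv C33 x * fst h)) (at ?X)"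
    using has_derivative_fst_function[of _ _ ?X] smooth_on_has_real_derivative[OF smooth_C(1) x]
      smooth_on_has_real_derivative[OF smooth_C(2) x] smooth_on_has_real_derivative[OF smooth_C(3) x]
      smooth_on_has_real_derivative[OF smooth_C(4) x] by simp_all
  have \<alpha>': "(\<alpha> has_derivative frechet_derivative \<alpha> (at ?X)) (at ?X)"
    using \<alpha>\<beta>\<gamma>(1) by (simp add: frechet_derivative_works)
  have half: "((\<lambda>X. C22 (fst X) / 2) has_derivative (\<lambda>h. deriv C22 x * fst h / 2)) (at ?X)"
    "((\<lambda>X. C23 (fst X) / 2) has_derivative (\<lambda>h. deriv C23 x * fst h / 2)) (at ?X)"
    "((\<lambda>X. C32 (fst X) / 2) has_derivative (\<lambda>h. deriv C32 x * fst h / 2)) (at ?X)"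
    "((\<lambda>X. (C22 (fst X) + \<alpha> X) / 2) has_derivative (\<lambda>h. (deriv C22 x * fst h + frechet_derivative \<alpha> (at ?X) h) / 2)) (at ?X)"
    "((\<lambda>X. (C33 (fst X) + \<alpha> X) / 2) has_derivative (\<lambda>h. (deriv C33 x * fst h + frechet_derivative \<alpha> (at ?X) h) / 2)) (at ?X)"
    using C'(1,2,3)[THEN bounded_linear.has_derivative[OF bounded_linear_divide]]
      has_derivative_add[OF C'(1) \<alpha>', THEN bounded_linear.has_derivative[OF bounded_linear_divide]]
      has_derivative_add[OF C'(4) \<alpha>', THEN bounded_linear.has_derivative[OF bounded_linear_divide]]
    by blast+
  note half_diff = half[THEN differentiableI] and half' = half[THEN frechet_derivative_at, symmetric]
  note sym = H_sym[OF X, of e2 e1] H_sym[OF X, of e3 e1] H_sym[OF X, of e3 e2]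
  have \<Gamma>_sym: "\<Gamma> e2 e1 ?X = \<Gamma> e1 e2 ?X" "\<Gamma> e3 e1 ?X = \<Gamma> e1 e3 ?X" "\<Gamma> e3 e2 ?X = \<Gamma> e2 e3 ?X"
    using sym by (simp_all add: \<Gamma>_def)
  have third: "frechet_derivative (H e1 e) (at ?X) e' = frechet_derivative (H e1 e') (at ?X) e" for e e'
    unfolding H_def by (rule symmetric_second_derivative[OF openV X smooth_F])
  have 11: "W ?X (frechet_derivative (H e1 e1) (at ?X) e) =
    (frechet_derivative \<alpha> (at ?X) e, frechet_derivative D2 (at ?X) e, frechet_derivative D3 (at ?X) e) +
    (\<alpha> ?X *\<^sub>R \<Gamma> e1 e ?X + D2 ?X *\<^sub>R \<Gamma> e2 e ?X + D3 ?X *\<^sub>R \<Gamma> e3 e ?X)" for e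
    by (rule W_third_derivative[OF X \<Gamma>(1) \<alpha>\<beta>\<gamma>(1) D])
  have 12: "W ?X (frechet_derivative (H e1 e2) (at ?X) e1) =
    (frechet_derivative \<beta> (at ?X) e1, (deriv C22 x + frechet_derivative \<alpha> (at ?X) e1) / 2, deriv C32 x / 2) +
    (\<beta> ?X *\<^sub>R \<Gamma> e1 e1 ?X + ((C22 x + \<alpha> ?X) / 2) *\<^sub>R \<Gamma> e2 e1 ?X + (C32 x / 2) *\<^sub>R \<Gamma> e3 e1 ?X)"
    by (rule W_third_derivative[OF X \<Gamma>(2) \<alpha>\<beta>\<gamma>(2) half_diff(4) half_diff(3), of e1, unfolded half', simplified])
  have 13: "W ?X (frechet_derivative (H e1 e3) (at ?X) e1) =
    (frechet_derivative \<gamma> (at ?X) e1, deriv C23 x / 2, (deriv C33 x + frechet_derivative \<alpha> (at ?X) e1) / 2) +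
    (\<gamma> ?X *\<^sub>R \<Gamma> e1 e1 ?X + (C23 x / 2) *\<^sub>R \<Gamma> e2 e1 ?X + ((C33 x + \<alpha> ?X) / 2) *\<^sub>R \<Gamma> e3 e1 ?X)"
    by (rule W_third_derivative[OF X \<Gamma>(3) \<alpha>\<beta>\<gamma>(3) half_diff(2) half_diff(5), of e1, unfolded half', simplified])
  have xy: "(frechet_derivative \<alpha> (at ?X) e2, frechet_derivative D2 (at ?X) e2, frechet_derivative D3 (at ?X) e2) +
      (\<alpha> ?X *\<^sub>R \<Gamma> e1 e2 ?X + D2 ?X *\<^sub>R \<Gamma> e2 e2 ?X + D3 ?X *\<^sub>R \<Gamma> e2 e3 ?X) =
    (frechet_derivative \<beta> (at ?X) e1, (deriv C22 x + frechet_derivative \<alpha> (at ?X) e1) / 2, deriv C32 x / 2) +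
      (\<beta> ?X *\<^sub>R \<Gamma> e1 e1 ?X + ((C22 x + \<alpha> ?X) / 2) *\<^sub>R \<Gamma> e1 e2 ?X + (C32 x / 2) *\<^sub>R \<Gamma> e1 e3 ?X)"
    using arg_cong[OF third[of e1 e2], of "W ?X"] unfolding 11 12 \<Gamma>_sym by simp
  have xz: "(frechet_derivative \<alpha> (at ?X) e3, frechet_derivative D2 (at ?X) e3, frechet_derivative D3 (at ?X) e3) +
      (\<alpha> ?X *\<^sub>R \<Gamma> e1 e3 ?X + D2 ?X *\<^sub>R \<Gamma> e2 e3 ?X + D3 ?X *\<^sub>R \<Gamma> e3 e3 ?X) =
    (frechet_derivative \<gamma> (at ?X) e1, deriv C23 x / 2, (deriv C33 x + frechet_derivative \<alpha> (at ?X) e1) / 2) +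
      (\<gamma> ?X *\<^sub>R \<Gamma> e1 e1 ?X + (C23 x / 2) *\<^sub>R \<Gamma> e1 e2 ?X + ((C33 x + \<alpha> ?X) / 2) *\<^sub>R \<Gamma> e1 e3 ?X)"
    using arg_cong[OF third[of e1 e3], of "W ?X"] unfolding 11 13 \<Gamma>_sym by simp
  note xy = xy[unfolded \<Gamma>[OF X], simplified] and xz = xz[unfolded \<Gamma>[OF X], simplified]
  note partials = partial_y_eq_frechet[OF D(1)] partial_y_eq_frechet[OF D(2)]
    partial_z_eq_frechet[OF D(1)] partial_z_eq_frechet[OF D(2)]
  show "1/2 * deriv C32 x + 1/4 * C33 x * C32 x + 1/4 * C22 x * C32 x = partial_y D3 (x, y, z)"
    unfolding partials using xy by (simp add: field_simps)
  show "1/2 * deriv C23 x + 1/4 * C23 x * C33 x + 1/4 * C23 x * C22 x = partial_z D2 (x, y, z)"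
    unfolding partials using xz by (simp add: field_simps)
  \<comment> \<open>Terms linear in \<open>\<alpha>\<close> cancel within each component. The
    subtraction removes the x-derivative of \<open>\<alpha>\<close>, its square,
    \<open>D2 * \<beta> + D3 * \<gamma>\<close> and \<open>C23 * C32\<close>, which enter both
    components alike.\<close>
  show "1/2 * deriv C33 x - 1/2 * deriv C22 x + 1/4 * C33 x * C33 x - 1/4 * C22 x * C22 x
         = partial_z D3 (x, y, z) - partial_y D2 (x, y, z)"
    unfolding partials using xy xz by (simp add: field_simps)
qed

end

section \<open>Sufficiency\<close>

text \<open>Since \<open>r' = 1 / s\<^sup>2\<close>, \<open>N\<close> is the derivative of the new dependent variable with respect to the new
  independent variable \<open>r\<close>.\<close>

lemma row_derivatives:
  fixes C22 C23 C32 C33 lam k2 k3 s \<sigma> p1 p2 b B y z y1 z1 :: "real \<Rightarrow> real"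
  assumes s: "(s has_real_derivative \<sigma> t) (at t)" and \<sigma>: "(\<sigma> has_real_derivative - lam t * s t) (at t)"
    and p1: "(p1 has_real_derivative C22 t / 2 * p1 t + C32 t / 2 * p2 t) (at t)"
    and p2: "(p2 has_real_derivative C23 t / 2 * p1 t + C33 t / 2 * p2 t) (at t)"
    and b: "(b has_real_derivative B t / (s t)\<^sup>2) (at t)"
    and B: "(B has_real_derivative s t * (p1 t * k2 t + p2 t * k3 t)) (at t)"
    and C: "(C22 has_real_derivative C22') (at t)" "(C23 has_real_derivative C23') (at t)"
      "(C32 has_real_derivative C32') (at t)" "(C33 has_real_derivative C33') (at t)"
    and yz: "(y has_real_derivative y1 t) (at t)" "(z has_real_derivative z1 t) (at t)"
      "(y1 has_real_derivative y2) (at t)" "(z1 has_real_derivative z2) (at t)"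
    and s0: "s t \<noteq> 0"
  defines "N \<equiv> \<lambda>t. s t * (p1 t * ((C22 t * y t + C23 t * z t) / 2 + y1 t)
      + p2 t * ((C32 t * y t + C33 t * z t) / 2 + z1 t)) - \<sigma> t * (p1 t * y t + p2 t * z t) + B t"
  shows "((\<lambda>t. (p1 t * y t + p2 t * z t) / s t + b t) has_real_derivative N t * (1 / (s t)\<^sup>2)) (at t)"
    and "(N has_real_derivative s t *
      (p1 t * (y2 + C22 t * y1 t + C23 t * z1 t + (k2 t
          + (C22' / 2 + (C22 t * C22 t + C23 t * C32 t) / 4 + lam t) * y t
          + (C23' / 2 + (C22 t * C23 t + C23 t * C33 t) / 4) * z t))
     + p2 t * (z2 + C32 t * y1 t + C33 t * z1 t + (k3 t
          + (C32' / 2 + (C32 t * C22 t + C33 t * C32 t) / 4) * y t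
          + (C33' / 2 + (C32 t * C23 t + C33 t * C33 t) / 4 + lam t) * z t)))) (at t)"
proof -
  show "((\<lambda>t. (p1 t * y t + p2 t * z t) / s t + b t) has_real_derivative N t * (1 / (s t)\<^sup>2)) (at t)"
    using s0 unfolding N_def
    by (auto intro!: derivative_eq_intros s p1 p2 b yz simp: power2_eq_square field_simps)
  show "(N has_real_derivative s t *
      (p1 t * (y2 + C22 t * y1 t + C23 t * z1 t + (k2 t
          + (C22' / 2 + (C22 t * C22 t + C23 t * C32 t) / 4 + lam t) * y t
          + (C23' / 2 + (C22 t * C23 t + C23 t * C33 t) / 4) * z t))
     + p2 t * (z2 + C32 t * y1 t + C33 t * z1 t + (k3 t
          + (C32' / 2 + (C32 t * C22 t + C33 t * C32 t) / 4) * y t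
          + (C33' / 2 + (C32 t * C23 t + C33 t * C33 t) / 4 + lam t) * z t)))) (at t)"
    \<comment> \<open>The product rule produces \<open>\<sigma>\<close> times the same row
      expression twice, with opposite signs. In the rest, \<open>P' = P C / 2\<close> and
      \<open>\<sigma>' = - lam * s\<close> create the entries of
      \<open>C' / 2 + C\<^sup>2 / 4 + lam I\<close>.\<close>
    unfolding N_def
    by (auto intro!: derivative_eq_intros s \<sigma> p1 p2 B C yz simp: field_simps)
qed

text \<open>As a function of \<open>r\<close>, \<open>V\<close> has first derivative
  \<open>N\<close> and second derivative \<open>E / r'\<close>, so it moves freely exactly when
  \<open>E\<close> vanishes. The converse part recovers \<open>N\<close> from \<open>\<eta>\<close>
  by the chain rule and uniqueness of derivatives.\<close>

lemma free_motion_in_new_variable: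
  fixes V N E r r' g :: "real \<Rightarrow> real"
  assumes I: "open I" "open (r ` I)"
    and V: "\<And>t. t \<in> I \<Longrightarrow> (V has_real_derivative N t * r' t) (at t)"
    and N: "\<And>t. t \<in> I \<Longrightarrow> (N has_real_derivative E t) (at t)"
    and r: "\<And>t. t \<in> I \<Longrightarrow> (r has_real_derivative r' t) (at t)" "\<And>t. t \<in> I \<Longrightarrow> r' t \<noteq> 0"
    and g: "\<And>t. t \<in> I \<Longrightarrow> g (r t) = t" "\<And>t. t \<in> I \<Longrightarrow> (g has_real_derivative 1 / r' t) (at (r t))"
  shows "(\<And>t. t \<in> I \<Longrightarrow> E t = 0) \<Longrightarrow> twice_differentiable_on (r ` I) (\<lambda>w. V (g w)) \<and>
      (\<forall>w\<in>r ` I. deriv (deriv (\<lambda>w. V (g w))) w = 0)"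
    and "twice_differentiable_on (r ` I) \<eta> \<Longrightarrow> (\<And>w. w \<in> r ` I \<Longrightarrow> deriv (deriv \<eta>) w = 0) \<Longrightarrow>
      (\<And>t. t \<in> I \<Longrightarrow> V t = \<eta> (r t)) \<Longrightarrow> t \<in> I \<Longrightarrow> E t = 0"
proof -
  assume E: "\<And>t. t \<in> I \<Longrightarrow> E t = 0"
  have 1: "((\<lambda>w. V (g w)) has_real_derivative N (g w)) (at w)" if w: "w \<in> r ` I" for w
  proof -
    obtain t where t: "t \<in> I" "w = r t" using w by blast
    have "(V has_real_derivative N t * r' t) (at (g w))" using V[OF t(1)] g(1)[OF t(1)] t(2) by simp
    from DERIV_chain2[where f = V and g = g, OF this, of "1 / r' t"] show ?thesis
      using g[OF t(1)] r(2)[OF t(1)] t(2) by simp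
  qed
  have 2: "((\<lambda>w. N (g w)) has_real_derivative 0) (at w)" if w: "w \<in> r ` I" for w
  proof -
    obtain t where t: "t \<in> I" "w = r t" using w by blast
    have "(N has_real_derivative 0) (at (g w))" using N[OF t(1)] g(1)[OF t(1)] t E by simp
    from DERIV_chain2[where f = N and g = g, OF this, of "1 / r' t"] show ?thesis
      using g[OF t(1)] t(2) by simp
  qed
  have 3: "(deriv (\<lambda>w. V (g w)) has_real_derivative 0) (at w)" if w: "w \<in> r ` I" for w
    by (rule has_field_derivative_transform_within_open[OF 2[OF w] I(2) w])
      (rule DERIV_imp_deriv[OF 1, symmetric])
  show "twice_differentiable_on (r ` I) (\<lambda>w. V (g w)) \<and> (\<forall>w\<in>r ` I. deriv (deriv (\<lambda>w. V (g w))) w = 0)"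
    unfolding twice_differentiable_on_def using 1 3 DERIV_imp_deriv[OF 3]
    by (auto simp: real_differentiable_def)
next
  assume \<eta>: "twice_differentiable_on (r ` I) \<eta>" "\<And>w. w \<in> r ` I \<Longrightarrow> deriv (deriv \<eta>) w = 0"
    "\<And>t. t \<in> I \<Longrightarrow> V t = \<eta> (r t)" and t: "t \<in> I"
  have \<eta>': "(\<eta> has_real_derivative deriv \<eta> (r t)) (at (r t))"
    "(deriv \<eta> has_real_derivative 0) (at (r t))" if "t \<in> I" for t
    using \<eta>(1) \<eta>(2)[of "r t"] that
    by (auto simp: twice_differentiable_on_def DERIV_deriv_iff_real_differentiable[symmetric])
  have N_eq: "deriv \<eta> (r t) = N t" if t: "t \<in> I" for t
  proof -
    have "((\<lambda>t. \<eta> (r t)) has_real_derivative deriv \<eta> (r t) * r' t) (at t)"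
      by (rule DERIV_chain2[OF \<eta>'(1)[OF t] r(1)[OF t]])
    then have "(V has_real_derivative deriv \<eta> (r t) * r' t) (at t)"
      by (rule has_field_derivative_transform_within_open[OF _ I(1) t]) (simp add: \<eta>(3))
    from DERIV_unique[OF this V[OF t]] show ?thesis using r(2)[OF t] by simp
  qed
  have "((\<lambda>t. deriv \<eta> (r t)) has_real_derivative 0 * r' t) (at t)"
    by (rule DERIV_chain2[OF \<eta>'(2)[OF t] r(1)[OF t]])
  then have "(N has_real_derivative 0 * r' t) (at t)"
    by (rule has_field_derivative_transform_within_open[OF _ I(1) t]) (simp add: N_eq)
  from DERIV_unique[OF N[OF t] this] show "E t = 0" by simp
qed

section \<open>The explicit linearizing map and its inverse\<close>

text \<open>\<open>(p1, p2)\<close> and \<open>(q1, q2)\<close> are the rows of \<open>P\<close>,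
  invertible by \<open>nonzero\<close>; \<open>B1\<close>, \<open>B2\<close> are
  \<open>s\<^sup>2\<close> times the derivatives of \<open>b1\<close>, \<open>b2\<close>, and
  \<open>g\<close> inverts \<open>r\<close>.\<close>

locale linearizing_data =
  fixes J :: "real set" and YZ :: "(real \<times> real) set"
    and C22 C23 C32 C33 lam k2 k3 s \<sigma> p1 p2 q1 q2 B1 B2 b1 b2 r g :: "real \<Rightarrow> real"
    and D2 D3 :: "real \<times> real \<times> real \<Rightarrow> real"
  assumes open_sets: "open J" "open YZ"
    and smooth_C: "smooth_on J C22" "smooth_on J C23" "smooth_on J C32" "smooth_on J C33"
    and smooth: "smooth_on J s" "smooth_on J p1" "smooth_on J p2" "smooth_on J q1" "smooth_on J q2"
      "smooth_on J b1" "smooth_on J b2" "smooth_on J r" "smooth_on (r ` J) g"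
    and s': "\<And>t. t \<in> J \<Longrightarrow> (s has_real_derivative \<sigma> t) (at t)"
    and \<sigma>': "\<And>t. t \<in> J \<Longrightarrow> (\<sigma> has_real_derivative - lam t * s t) (at t)"
    and p': "\<And>t. t \<in> J \<Longrightarrow> (p1 has_real_derivative C22 t / 2 * p1 t + C32 t / 2 * p2 t) (at t)"
      "\<And>t. t \<in> J \<Longrightarrow> (p2 has_real_derivative C23 t / 2 * p1 t + C33 t / 2 * p2 t) (at t)"
    and q': "\<And>t. t \<in> J \<Longrightarrow> (q1 has_real_derivative C22 t / 2 * q1 t + C32 t / 2 * q2 t) (at t)"
      "\<And>t. t \<in> J \<Longrightarrow> (q2 has_real_derivative C23 t / 2 * q1 t + C33 t / 2 * q2 t) (at t)"
    and b': "\<And>t. t \<in> J \<Longrightarrow> (b1 has_real_derivative B1 t / (s t)\<^sup>2) (at t)"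
      "\<And>t. t \<in> J \<Longrightarrow> (b2 has_real_derivative B2 t / (s t)\<^sup>2) (at t)"
    and B': "\<And>t. t \<in> J \<Longrightarrow> (B1 has_real_derivative s t * (p1 t * k2 t + p2 t * k3 t)) (at t)"
      "\<And>t. t \<in> J \<Longrightarrow> (B2 has_real_derivative s t * (q1 t * k2 t + q2 t * k3 t)) (at t)"
    and r': "\<And>t. t \<in> J \<Longrightarrow> (r has_real_derivative 1 / (s t)\<^sup>2) (at t)"
    and g: "\<And>t. t \<in> J \<Longrightarrow> g (r t) = t" "\<And>t. t \<in> J \<Longrightarrow> (g has_real_derivative 1 / (1 / (s t)\<^sup>2)) (at (r t))"
    and nonzero: "\<And>t. t \<in> J \<Longrightarrow> s t \<noteq> 0" "\<And>t. t \<in> J \<Longrightarrow> p1 t * q2 t - p2 t * q1 t \<noteq> 0"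
    and D2: "\<And>t y z. t \<in> J \<Longrightarrow> (y, z) \<in> YZ \<Longrightarrow> D2 (t, y, z) = k2 t
          + (deriv C22 t / 2 + (C22 t * C22 t + C23 t * C32 t) / 4 + lam t) * y
          + (deriv C23 t / 2 + (C22 t * C23 t + C23 t * C33 t) / 4) * z"
    and D3: "\<And>t y z. t \<in> J \<Longrightarrow> (y, z) \<in> YZ \<Longrightarrow> D3 (t, y, z) = k3 t
          + (deriv C32 t / 2 + (C32 t * C22 t + C33 t * C32 t) / 4) * y
          + (deriv C33 t / 2 + (C32 t * C23 t + C33 t * C33 t) / 4 + lam t) * z"
begin

definition \<phi> :: "real \<times> real \<times> real \<Rightarrow> real \<times> real \<times> real" where
  "\<phi> X = (r (fst X), (p1 (fst X) * fst (snd X) + p2 (fst X) * snd (snd X)) / s (fst X) + b1 (fst X),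
     (q1 (fst X) * fst (snd X) + q2 (fst X) * snd (snd X)) / s (fst X) + b2 (fst X))"

text \<open>\<open>v'\<close> and \<open>w'\<close> recover the two components of \<open>P Y\<close>
  from a target point: the shift by \<open>b\<close> and the division by \<open>s\<close> are undone
  at \<open>x = g u\<close>.\<close>

definition v' :: "real \<times> real \<times> real \<Rightarrow> real" where
  "v' Y = (fst (snd Y) - b1 (g (fst Y))) * s (g (fst Y))"

definition w' :: "real \<times> real \<times> real \<Rightarrow> real" where
  "w' Y = (snd (snd Y) - b2 (g (fst Y))) * s (g (fst Y))"

text \<open>Cramer's rule for \<open>P\<close>, applied to the recovered components of
  \<open>P Y\<close>.\<close>

definition \<psi> :: "real \<times> real \<times> real \<Rightarrow> real \<times> real \<times> real" where
  "\<psi> Y = (let x = g (fst Y); \<Delta> = p1 x * q2 x - p2 x * q1 x in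
     (x, (q2 x * v' Y - p2 x * w' Y) / \<Delta>, (p1 x * w' Y - q1 x * v' Y) / \<Delta>))"

lemma \<psi>_\<phi>: assumes "X \<in> J \<times> YZ" shows "\<psi> (\<phi> X) = X"
proof -
  obtain x y z where X: "X = (x, y, z)" by (metis prod.collapse)
  have x: "x \<in> J" using assms X by simp
  have v: "v' (\<phi> X) = p1 x * y + p2 x * z" "w' (\<phi> X) = q1 x * y + q2 x * z"
    using g(1)[OF x] nonzero(1)[OF x] by (simp_all add: v'_def w'_def \<phi>_def X)
  have "q2 x * (p1 x * y + p2 x * z) - p2 x * (q1 x * y + q2 x * z) = y * (p1 x * q2 x - p2 x * q1 x)"
    "p1 x * (q1 x * y + q2 x * z) - q1 x * (p1 x * y + p2 x * z) = z * (p1 x * q2 x - p2 x * q1 x)"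
    by (simp_all add: algebra_simps)
  then show ?thesis
    using g(1)[OF x] nonzero(2)[OF x] unfolding \<psi>_def v by (simp add: \<phi>_def X Let_def)
qed

lemma smooth_\<phi>: "smooth_on (J \<times> YZ) \<phi>"
proof -
  have V: "open (J \<times> YZ)" using open_sets by (rule open_Times)
  have f: "smooth_on (J \<times> YZ) (\<lambda>X. f (fst X))" if "smooth_on J f" for f :: "real \<Rightarrow> real"
    by (rule smooth_on_compose[OF V that smooth_on_fst[OF V smooth_on_ident[OF V]]]) auto
  show ?thesis
    unfolding \<phi>_def
    by (intro smooth_on_Pair smooth_on_add smooth_on_mult smooth_on_divide f smooth smooth_on_fst
        smooth_on_snd smooth_on_ident V) (use nonzero in auto)
qed

lemma open_image: "open (\<phi> ` (J \<times> YZ))"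
proof (rule invariance_of_domain)
  show "continuous_on (J \<times> YZ) \<phi>" by (rule smooth_on_imp_continuous_on[OF smooth_\<phi>])
  show "open (J \<times> YZ)" using open_sets by (rule open_Times)
  show "inj_on \<phi> (J \<times> YZ)" by (rule inj_on_inverseI[of _ \<psi>]) (rule \<psi>_\<phi>)
qed

lemma smooth_\<psi>: "smooth_on (\<phi> ` (J \<times> YZ)) \<psi>"
proof -
  note V = open_image
  have r: "fst Y \<in> r ` J" if Y: "Y \<in> \<phi> ` (J \<times> YZ)" for Y
  proof -
    obtain X where "X \<in> J \<times> YZ" "Y = \<phi> X" using Y by blast
    then show ?thesis by (auto simp: \<phi>_def)
  qed
  then have gJ: "g (fst Y) \<in> J" if "Y \<in> \<phi> ` (J \<times> YZ)" for Y
    using that g(1) by fastforce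
  have g_smooth: "smooth_on (\<phi> ` (J \<times> YZ)) (\<lambda>Y. g (fst Y))"
    by (rule smooth_on_compose[OF V smooth(9) smooth_on_fst[OF V smooth_on_ident[OF V]]])
      (rule image_subsetI, rule r)
  have f: "smooth_on (\<phi> ` (J \<times> YZ)) (\<lambda>Y. f (g (fst Y)))" if "smooth_on J f" for f :: "real \<Rightarrow> real"
    by (rule smooth_on_compose[OF V that g_smooth]) (use gJ in auto)
  show ?thesis
    unfolding \<psi>_def v'_def w'_def Let_def
    by (intro smooth_on_Pair smooth_on_diff smooth_on_mult smooth_on_divide f g_smooth smooth smooth_on_fst
        smooth_on_snd smooth_on_ident V nonzero(2) gJ)
qed

lemma point_transformation: "point_transformation (J \<times> YZ) \<phi>"
  unfolding point_transformation_def
  using open_Times[OF open_sets] smooth_\<phi> open_image smooth_\<psi> \<psi>_\<phi> by blast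

text \<open>With \<open>E2\<close>, \<open>E3\<close> the left-hand sides of the system along a
  curve, the second derivatives of \<open>v\<close>, \<open>w\<close> in the new variable are
  \<open>s^3\<close> times the components of \<open>P (E2, E3)\<close>. As \<open>P\<close> is
  invertible, they vanish exactly on solutions.\<close>

lemma maps_system: "maps_system \<phi> (J \<times> YZ) (linear_in_first_derivatives C22 C23 C32 C33 D2 D3) free_particle"
  unfolding maps_system_def Let_def
proof (intro allI impI, elim conjE)
  fix I y z
  assume I: "open I" "is_interval I" and y: "twice_differentiable_on I y" and z: "twice_differentiable_on I z"
    and "\<forall>t\<in>I. (t, y t, z t) \<in> J \<times> YZ"
  then have J: "t \<in> J" "(y t, z t) \<in> YZ" if "t \<in> I" for t using that by auto
  define E2 where "E2 t = deriv (deriv y) t + C22 t * deriv y t + C23 t * deriv z t + D2 (t, y t, z t)" for t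
  define E3 where "E3 t = deriv (deriv z) t + C32 t * deriv y t + C33 t * deriv z t + D3 (t, y t, z t)" for t
  have solves_iff: "solves (linear_in_first_derivatives C22 C23 C32 C33 D2 D3) I y z \<longleftrightarrow> (\<forall>t\<in>I. E2 t = 0 \<and> E3 t = 0)"
    using y z by (simp add: solves_def linear_in_first_derivatives_def E2_def E3_def)
  have yz': "(y has_real_derivative deriv y t) (at t)" "(z has_real_derivative deriv z t) (at t)"
    "(deriv y has_real_derivative deriv (deriv y) t) (at t)"
    "(deriv z has_real_derivative deriv (deriv z) t) (at t)" if "t \<in> I" for t
    using y z that by (simp_all add: twice_differentiable_on_def DERIV_deriv_iff_real_differentiable)
  define v where "v t = (p1 t * y t + p2 t * z t) / s t + b1 t" for t
  define w where "w t = (q1 t * y t + q2 t * z t) / s t + b2 t" for t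
  define Nv where "Nv = (\<lambda>t. s t * (p1 t * ((C22 t * y t + C23 t * z t) / 2 + deriv y t)
      + p2 t * ((C32 t * y t + C33 t * z t) / 2 + deriv z t)) - \<sigma> t * (p1 t * y t + p2 t * z t) + B1 t)"
  define Nw where "Nw = (\<lambda>t. s t * (q1 t * ((C22 t * y t + C23 t * z t) / 2 + deriv y t)
      + q2 t * ((C32 t * y t + C33 t * z t) / 2 + deriv z t)) - \<sigma> t * (q1 t * y t + q2 t * z t) + B2 t)"
  have C': "(C22 has_real_derivative deriv C22 t) (at t)" "(C23 has_real_derivative deriv C23 t) (at t)"
    "(C32 has_real_derivative deriv C32 t) (at t)" "(C33 has_real_derivative deriv C33 t) (at t)" if "t \<in> J" for t
    using smooth_C[THEN smooth_on_has_real_derivative] that by blast+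
  have v: "(v has_real_derivative Nv t * (1 / (s t)\<^sup>2)) (at t)"
    "(Nv has_real_derivative s t * (p1 t * E2 t + p2 t * E3 t)) (at t)"
    "(w has_real_derivative Nw t * (1 / (s t)\<^sup>2)) (at t)"
    "(Nw has_real_derivative s t * (q1 t * E2 t + q2 t * E3 t)) (at t)" if "t \<in> I" for t
  proof -
    have t: "t \<in> J" by (rule J(1)[OF that])
    note rowp = row_derivatives[where s = s and \<sigma> = \<sigma> and lam = lam and ?k2.0 = k2 and ?k3.0 = k3 and ?C22.0 = C22 and ?C23.0 = C23
      and ?C32.0 = C32 and ?C33.0 = C33 and y = y and z = z and ?y1.0 = "deriv y" and ?z1.0 = "deriv z" and t = t
      and ?p1.0 = p1 and ?p2.0 = p2 and B = B1 and b = b1,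
      OF s' \<sigma>' p'(1) p'(2) b'(1) B'(1) C' yz' nonzero(1), OF t t t t t t t t t t that that that that t]
    note rowq = row_derivatives[where s = s and \<sigma> = \<sigma> and lam = lam and ?k2.0 = k2 and ?k3.0 = k3 and ?C22.0 = C22 and ?C23.0 = C23
      and ?C32.0 = C32 and ?C33.0 = C33 and y = y and z = z and ?y1.0 = "deriv y" and ?z1.0 = "deriv z" and t = t
      and ?p1.0 = q1 and ?p2.0 = q2 and B = B2 and b = b2,
      OF s' \<sigma>' q'(1) q'(2) b'(2) B'(2) C' yz' nonzero(1), OF t t t t t t t t t t that that that that t]
    show "(v has_real_derivative Nv t * (1 / (s t)\<^sup>2)) (at t)"
      "(w has_real_derivative Nw t * (1 / (s t)\<^sup>2)) (at t)"
      using rowp(1) rowq(1) unfolding v_def w_def Nv_def Nw_def by auto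
    show "(Nv has_real_derivative s t * (p1 t * E2 t + p2 t * E3 t)) (at t)"
      "(Nw has_real_derivative s t * (q1 t * E2 t + q2 t * E3 t)) (at t)"
      using rowp(2) rowq(2) unfolding Nv_def Nw_def E2_def E3_def D2[OF t J(2)[OF that]] D3[OF t J(2)[OF that]] by auto
  qed
  have rI: "(r has_real_derivative 1 / (s t)\<^sup>2) (at t)" "1 / (s t)\<^sup>2 \<noteq> 0" "g (r t) = t"
    "(g has_real_derivative 1 / (1 / (s t)\<^sup>2)) (at (r t))" if "t \<in> I" for t
    using r'[OF J(1)[OF that]] nonzero(1)[OF J(1)[OF that]] g[OF J(1)[OF that]] by simp_all
  have "open (r ` I)"
  proof (rule invariance_of_domain[OF _ I(1)])
    show "continuous_on I r"
      by (rule DERIV_continuous_on, rule has_field_derivative_at_within, rule rI(1))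
    show "inj_on r I" by (rule inj_on_inverseI[of _ g]) (rule rI(3))
  qed
  note free_v = free_motion_in_new_variable[where V = v and N = Nv and r = r and g = g,
      OF I(1) this v(1) v(2) rI]
  note free_w = free_motion_in_new_variable[where V = w and N = Nw and r = r and g = g,
      OF I(1) \<open>open (r ` I)\<close> v(3) v(4) rI]
  have \<phi>_eq: "\<phi> (t, y t, z t) = (r t, v t, w t)" for t
    by (simp add: \<phi>_def v_def w_def)
  show "solves (linear_in_first_derivatives C22 C23 C32 C33 D2 D3) I y z \<longleftrightarrow>
    (\<exists>\<eta> \<zeta>. (\<forall>t\<in>I. \<phi> (t, y t, z t) = (fst (\<phi> (t, y t, z t)), \<eta> (fst (\<phi> (t, y t, z t))), \<zeta> (fst (\<phi> (t, y t, z t))))) \<and>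
      solves free_particle ((\<lambda>t. fst (\<phi> (t, y t, z t))) ` I) \<eta> \<zeta>)"
    unfolding solves_iff \<phi>_eq
  proof
    assume "\<forall>t\<in>I. E2 t = 0 \<and> E3 t = 0"
    then have "twice_differentiable_on (r ` I) (\<lambda>x. v (g x)) \<and> (\<forall>x\<in>r ` I. deriv (deriv (\<lambda>x. v (g x))) x = 0)"
      "twice_differentiable_on (r ` I) (\<lambda>x. w (g x)) \<and> (\<forall>x\<in>r ` I. deriv (deriv (\<lambda>x. w (g x))) x = 0)"
      by (intro free_v(1) free_w(1); simp)+
    then have "solves free_particle (r ` I) (\<lambda>x. v (g x)) (\<lambda>x. w (g x))"
      by (auto simp: solves_def free_particle_def)
    then show "\<exists>\<eta> \<zeta>. (\<forall>t\<in>I. (r t, v t, w t) = (fst (r t, v t, w t), \<eta> (fst (r t, v t, w t)), \<zeta> (fst (r t, v t, w t)))) \<and>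
      solves free_particle ((\<lambda>t. fst (r t, v t, w t)) ` I) \<eta> \<zeta>"
      using rI(3) by (intro exI[of _ "\<lambda>x. v (g x)"] exI[of _ "\<lambda>x. w (g x)"]) simp
  next
    assume "\<exists>\<eta> \<zeta>. (\<forall>t\<in>I. (r t, v t, w t) = (fst (r t, v t, w t), \<eta> (fst (r t, v t, w t)), \<zeta> (fst (r t, v t, w t)))) \<and>
      solves free_particle ((\<lambda>t. fst (r t, v t, w t)) ` I) \<eta> \<zeta>"
    then obtain \<eta> \<zeta> where eq: "\<And>t. t \<in> I \<Longrightarrow> v t = \<eta> (r t)" "\<And>t. t \<in> I \<Longrightarrow> w t = \<zeta> (r t)"
      and sol: "solves free_particle (r ` I) \<eta> \<zeta>" by auto
    show "\<forall>t\<in>I. E2 t = 0 \<and> E3 t = 0"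
    proof
      fix t assume t: "t \<in> I"
      have "s t * (p1 t * E2 t + p2 t * E3 t) = 0"
        using sol eq(1) t by (intro free_v(2)[of \<eta>]) (auto simp: solves_def free_particle_def)
      moreover have "s t * (q1 t * E2 t + q2 t * E3 t) = 0"
        using sol eq(2) t by (intro free_w(2)[of \<zeta>]) (auto simp: solves_def free_particle_def)
      ultimately have *: "p1 t * E2 t + p2 t * E3 t = 0" "q1 t * E2 t + q2 t * E3 t = 0"
        using nonzero(1)[OF J(1)[OF t]] by auto
      \<comment> \<open>Multiplication by the adjugate of \<open>P\<close> isolates each of
        \<open>E2\<close>, \<open>E3\<close>.\<close>
      have "(p1 t * q2 t - p2 t * q1 t) * E2 t = q2 t * (p1 t * E2 t + p2 t * E3 t) - p2 t * (q1 t * E2 t + q2 t * E3 t)"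
        "(p1 t * q2 t - p2 t * q1 t) * E3 t = p1 t * (q1 t * E2 t + q2 t * E3 t) - q1 t * (p1 t * E2 t + p2 t * E3 t)"
        by (simp_all add: algebra_simps)
      then show "E2 t = 0 \<and> E3 t = 0"
        using nonzero(2)[OF J(1)[OF t]] unfolding * by simp
    qed
  qed
qed

end

text \<open>The conditions determine all first derivatives of \<open>D\<^sup>2, D\<^sup>3\<close> in \<open>y\<close> and \<open>z\<close> except a common
  term \<open>m\<close> of \<open>D\<^sup>2\<^sub>y\<close> and \<open>D\<^sup>3\<^sub>z\<close>. Comparing the latter on the lines \<open>y = y0\<close> and \<open>z = z0\<close> shows that
  \<open>m\<close> depends on \<open>x\<close> only.\<close>

lemma affine_in_dependent_variables:
  assumes box: "ball x0 \<delta> \<times> ball y0 \<delta> \<times> ball z0 \<delta> \<subseteq> U" and D: "smooth_on U D2" "smooth_on U D3"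
    and cond: "\<And>x y z. (x, y, z) \<in> U \<Longrightarrow> partial_z D2 (x, y, z) = b x"
      "\<And>x y z. (x, y, z) \<in> U \<Longrightarrow> partial_y D3 (x, y, z) = c x"
      "\<And>x y z. (x, y, z) \<in> U \<Longrightarrow> partial_z D3 (x, y, z) - partial_y D2 (x, y, z) = d x"
    and xyz: "x \<in> ball x0 \<delta>" "y \<in> ball y0 \<delta>" "z \<in> ball z0 \<delta>"
  defines "m \<equiv> partial_y D2 (x, y0, z0)"
  shows "D2 (x, y, z) = D2 (x, y0, z0) + m * (y - y0) + b x * (z - z0)"
    and "D3 (x, y, z) = D3 (x, y0, z0) + c x * (y - y0) + (m + d x) * (z - z0)"
proof -
  have "dist x0 x < \<delta>" using xyz(1) by simp
  then have "\<delta> > 0" using zero_le_dist[of x0 x] by linarith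
  then have y0: "y0 \<in> ball y0 \<delta>" and z0: "z0 \<in> ball z0 \<delta>" by simp_all
  have U: "(x, y, z) \<in> U" if "y \<in> ball y0 \<delta>" "z \<in> ball z0 \<delta>" for y z
    using box xyz(1) that by blast
  have int: "is_interval (ball y0 \<delta>)" "is_interval (ball z0 \<delta>)"
    by (simp_all add: is_interval_ball_real)
  have py: "((\<lambda>t. f (x, t, z)) has_real_derivative partial_y f (x, y, z)) (at y)"
    and pz: "((\<lambda>t. f (x, y, t)) has_real_derivative partial_z f (x, y, z)) (at z)"
    if "smooth_on U f" "y \<in> ball y0 \<delta>" "z \<in> ball z0 \<delta>" for f y z
    using has_real_derivative_partial_y[of f x y z] has_real_derivative_partial_z[of f x y z]
      partial_y_eq_frechet[of f x y z] partial_z_eq_frechet[of f x y z]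
      smooth_on_differentiable[OF that(1) U[OF that(2,3)]] by simp_all
  have D2z: "D2 (x, y, z) = D2 (x, y, z0) + b x * (z - z0)" if "y \<in> ball y0 \<delta>" "z \<in> ball z0 \<delta>" for y z
    using pz[OF D(1) that(1)] cond(1)[OF U[OF that(1)]]
    by (intro constant_derivative_imp_linear[OF int(2) that(2) z0]) metis
  have D3y: "D3 (x, y, z) = D3 (x, y0, z) + c x * (y - y0)" if "y \<in> ball y0 \<delta>" "z \<in> ball z0 \<delta>" for y z
    using py[OF D(2) _ that(2)] cond(2)[OF U[OF _ that(2)]]
    by (intro constant_derivative_imp_linear[OF int(1) that(1) y0]) metis
  \<comment> \<open>By \<open>D3y\<close>, \<open>D3 (x, y, _)\<close> and
    \<open>D3 (x, y0, _)\<close> differ by a constant and share their z-derivative; the third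
    condition transfers this independence of \<open>y\<close> to the y-derivative of
    \<open>D2\<close>.\<close>
  have pyD2: "partial_y D2 (x, y, z0) = m" if y: "y \<in> ball y0 \<delta>" for y
  proof -
    have "((\<lambda>t. D3 (x, y0, t) + c x * (y - y0)) has_real_derivative partial_z D3 (x, y0, z0) + 0) (at z0)"
      by (intro DERIV_add DERIV_const pz[OF D(2) y0 z0])
    then have "((\<lambda>t. D3 (x, y, t)) has_real_derivative partial_z D3 (x, y0, z0) + 0) (at z0)"
      by (rule has_field_derivative_transform_within_open[OF _ open_ball z0]) (simp only: D3y[OF y])
    from DERIV_unique[OF this pz[OF D(2) y z0]]
    have "partial_z D3 (x, y, z0) = partial_z D3 (x, y0, z0)" by simp
    then show ?thesis using cond(3)[OF U[OF y z0]] cond(3)[OF U[OF y0 z0]] by (simp add: m_def)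
  qed
  \<comment> \<open>Likewise, \<open>D2z\<close> makes the y-derivative of \<open>D2\<close> on
    \<open>y = y0\<close> independent of \<open>z\<close>.\<close>
  have pzD3: "partial_z D3 (x, y0, z) = m + d x" if z: "z \<in> ball z0 \<delta>" for z
  proof -
    have "((\<lambda>t. D2 (x, t, z0) + b x * (z - z0)) has_real_derivative partial_y D2 (x, y0, z0) + 0) (at y0)"
      by (intro DERIV_add DERIV_const py[OF D(1) y0 z0])
    then have "((\<lambda>t. D2 (x, t, z)) has_real_derivative partial_y D2 (x, y0, z0) + 0) (at y0)"
      by (rule has_field_derivative_transform_within_open[OF _ open_ball y0]) (simp only: D2z[OF _ z])
    from DERIV_unique[OF this py[OF D(1) y0 z]]
    have "partial_y D2 (x, y0, z) = m" by (simp add: m_def)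
    then show ?thesis using cond(3)[OF U[OF y0 z]] by simp
  qed
  have "D2 (x, y, z0) = D2 (x, y0, z0) + m * (y - y0)"
    using py[OF D(1) _ z0] pyD2
    by (intro constant_derivative_imp_linear[OF int(1) xyz(2) y0]) metis
  then show "D2 (x, y, z) = D2 (x, y0, z0) + m * (y - y0) + b x * (z - z0)"
    using D2z[OF xyz(2,3)] by simp
  have "D3 (x, y0, z) = D3 (x, y0, z0) + (m + d x) * (z - z0)"
    using pz[OF D(2) y0] pzD3
    by (intro constant_derivative_imp_linear[OF int(2) xyz(3) z0]) metis
  then show "D3 (x, y, z) = D3 (x, y0, z0) + c x * (y - y0) + (m + d x) * (z - z0)"
    using D3y[OF xyz(2,3)] by simp
qed

section \<open>Local existence of the data\<close>

text \<open>The initial values \<open>s = 1\<close> and \<open>P = I\<close> at \<open>x0\<close>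
  keep \<open>s\<close> and the determinant nonzero nearby, so the divisions make sense. Every
  equation is solved on an interval of its own, and \<open>J\<close> lies in all of them.\<close>

lemma exists_linearizing_data:
  assumes S: "open S" "x0 \<in> S" and YZ: "open YZ"
    and C: "smooth_on S C22" "smooth_on S C23" "smooth_on S C32" "smooth_on S C33"
    and lam: "smooth_on S lam" and k: "smooth_on S k2" "smooth_on S k3"
    and D2: "\<And>t y z. t \<in> S \<Longrightarrow> (y, z) \<in> YZ \<Longrightarrow> D2 (t, y, z) = k2 t
          + (deriv C22 t / 2 + (C22 t * C22 t + C23 t * C32 t) / 4 + lam t) * y
          + (deriv C23 t / 2 + (C22 t * C23 t + C23 t * C33 t) / 4) * z"
    and D3: "\<And>t y z. t \<in> S \<Longrightarrow> (y, z) \<in> YZ \<Longrightarrow> D3 (t, y, z) = k3 t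
          + (deriv C32 t / 2 + (C32 t * C22 t + C33 t * C32 t) / 4) * y
          + (deriv C33 t / 2 + (C32 t * C23 t + C33 t * C33 t) / 4 + lam t) * z"
  obtains J s \<sigma> p1 p2 q1 q2 B1 B2 b1 b2 r g where "x0 \<in> J" "J \<subseteq> S"
    "linearizing_data J YZ C22 C23 C32 C33 lam k2 k3 s \<sigma> p1 p2 q1 q2 B1 B2 b1 b2 r g D2 D3"
proof -
  have half: "smooth_on S (\<lambda>t. f t / 2)" if "smooth_on S f" for f :: "real \<Rightarrow> real"
    by (rule smooth_on_divide[OF S(1) that smooth_on_const[OF S(1)]]) simp
  have c01: "smooth_on S (\<lambda>_. 0::real)" "smooth_on S (\<lambda>_. 1::real)"
    by (rule smooth_on_const[OF S(1)])+
  note cont = smooth_on_imp_continuous_on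
  have mlam: "smooth_on S (\<lambda>t. - lam t)" by (rule smooth_on_minus[OF S(1) lam])
  \<comment> \<open>\<open>s'' = - lam * s\<close> as a first-order system for \<open>s\<close> and
    \<open>\<sigma>\<close>.\<close>
  obtain \<delta>1 s \<sigma> where s: "\<delta>1 > 0" "ball x0 \<delta>1 \<subseteq> S" "s x0 = 1" "\<sigma> x0 = 0"
    "\<And>t. t \<in> ball x0 \<delta>1 \<Longrightarrow> (s has_real_derivative 0 * s t + 1 * \<sigma> t) (at t)"
    "\<And>t. t \<in> ball x0 \<delta>1 \<Longrightarrow> (\<sigma> has_real_derivative - lam t * s t + 0 * \<sigma> t) (at t)"
    using linear_ode_2[OF S cont[OF c01(1)] cont[OF c01(2)] cont[OF mlam] cont[OF c01(1)]] by metis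
  \<comment> \<open>\<open>P\<close> multiplies \<open>C\<close> from the left, so each row, read as
    a column, obeys a system with the transposed matrix; hence the order
    \<open>C(1,3,2,4)\<close>.\<close>
  obtain \<delta>2 p1 p2 where p: "\<delta>2 > 0" "ball x0 \<delta>2 \<subseteq> S" "p1 x0 = 1" "p2 x0 = 0"
    "\<And>t. t \<in> ball x0 \<delta>2 \<Longrightarrow> (p1 has_real_derivative C22 t / 2 * p1 t + C32 t / 2 * p2 t) (at t)"
    "\<And>t. t \<in> ball x0 \<delta>2 \<Longrightarrow> (p2 has_real_derivative C23 t / 2 * p1 t + C33 t / 2 * p2 t) (at t)"
    using linear_ode_2[OF S C(1,3,2,4)[THEN half, THEN cont]] by metis
  obtain \<delta>3 q1 q2 where q: "\<delta>3 > 0" "ball x0 \<delta>3 \<subseteq> S" "q1 x0 = 0" "q2 x0 = 1"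
    "\<And>t. t \<in> ball x0 \<delta>3 \<Longrightarrow> (q1 has_real_derivative C22 t / 2 * q1 t + C32 t / 2 * q2 t) (at t)"
    "\<And>t. t \<in> ball x0 \<delta>3 \<Longrightarrow> (q2 has_real_derivative C23 t / 2 * q1 t + C33 t / 2 * q2 t) (at t)"
    using linear_ode_2[OF S C(1,3,2,4)[THEN half, THEN cont]] by metis
  define T where "T = ball x0 \<delta>1 \<inter> ball x0 \<delta>2 \<inter> ball x0 \<delta>3"
  have T: "open T" "x0 \<in> T" "T \<subseteq> S" "T \<subseteq> ball x0 \<delta>1" "T \<subseteq> ball x0 \<delta>2" "T \<subseteq> ball x0 \<delta>3"
    using s(1,2) p(1) q(1) by (auto simp: T_def)
  note sub = smooth_on_subset[OF _ T(3)]
  have s': "(s has_real_derivative \<sigma> t) (at t)" "(\<sigma> has_real_derivative - lam t * s t) (at t)" if "t \<in> T" for t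
    using s(5)[of t] s(6)[of t] that T(4) by auto
  have p': "(p1 has_real_derivative C22 t / 2 * p1 t + C32 t / 2 * p2 t) (at t)"
    "(p2 has_real_derivative C23 t / 2 * p1 t + C33 t / 2 * p2 t) (at t)" if "t \<in> T" for t
    using p(5,6)[of t] that T(5) by auto
  have q': "(q1 has_real_derivative C22 t / 2 * q1 t + C32 t / 2 * q2 t) (at t)"
    "(q2 has_real_derivative C23 t / 2 * q1 t + C33 t / 2 * q2 t) (at t)" if "t \<in> T" for t
    using q(5,6)[of t] that T(6) by auto
  have smooth_s: "smooth_on T s"
    by (rule smooth_on_linear_ode_2(1)[where X = s and Y = \<sigma>, OF T(1) c01(1)[THEN sub] c01(2)[THEN sub] mlam[THEN sub] c01(1)[THEN sub]])
      (use s(5,6) T(4) in auto)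
  have smooth_p: "smooth_on T p1" "smooth_on T p2"
    by (rule smooth_on_linear_ode_2[where X = p1 and Y = p2, OF T(1) C(1,3,2,4)[THEN half, THEN sub] p']; assumption)+
  have smooth_q: "smooth_on T q1" "smooth_on T q2"
    by (rule smooth_on_linear_ode_2[where X = q1 and Y = q2, OF T(1) C(1,3,2,4)[THEN half, THEN sub] q']; assumption)+
  define \<Delta> where "\<Delta> t = p1 t * q2 t - p2 t * q1 t" for t
  have smooth_\<Delta>: "smooth_on T \<Delta>"
    unfolding \<Delta>_def by (intro smooth_on_diff smooth_on_mult T(1) smooth_p smooth_q)
  define R where "R = {t \<in> T. s t * \<Delta> t \<noteq> 0}"
  have R: "open R" "x0 \<in> R" "R \<subseteq> T"
  proof -
    have "open (T \<inter> (\<lambda>t. s t * \<Delta> t) -` (- {0}))"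
      by (rule continuous_open_preimage[OF cont[OF smooth_on_mult[OF T(1) smooth_s smooth_\<Delta>]] T(1)]) auto
    then show "open R" by (simp add: R_def Int_def vimage_def)
    show "x0 \<in> R" "R \<subseteq> T" using T(2) s(3) p(3,4) q(3,4) by (auto simp: R_def \<Delta>_def)
  qed
  have nz: "s t \<noteq> 0" "\<Delta> t \<noteq> 0" if "t \<in> R" for t using that by (auto simp: R_def)
  have subR: "smooth_on R f" if "smooth_on S f" for f :: "real \<Rightarrow> real"
    by (rule smooth_on_subset[OF that]) (use R T in blast)
  note TR = smooth_on_subset[OF _ R(3)]
  have sq: "smooth_on R (\<lambda>t. (s t)\<^sup>2)"
    unfolding power2_eq_square by (intro smooth_on_mult R(1) TR[OF smooth_s])
  have r1: "smooth_on R (\<lambda>t. 1 / (s t)\<^sup>2)"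
    by (rule smooth_on_divide[OF R(1) smooth_on_const[OF R(1)] sq]) (use nz in simp)
  have B: "smooth_on R (\<lambda>t. s t * (f t * k2 t + h t * k3 t))" if "smooth_on T f" "smooth_on T h" for f h
    by (intro smooth_on_mult smooth_on_add R(1) TR[OF smooth_s] TR[OF that(1)] TR[OF that(2)] subR k)
  have primitive: "\<exists>\<delta> F. \<delta> > 0 \<and> ball x0 \<delta> \<subseteq> R' \<and> (\<forall>t\<in>ball x0 \<delta>. (F has_real_derivative f t) (at t)) \<and> smooth_on (ball x0 \<delta>) F"
    if R': "open R'" "x0 \<in> R'" "smooth_on R' f" for R' and f :: "real \<Rightarrow> real"
  proof -
    obtain \<delta> F where F: "\<delta> > 0" "ball x0 \<delta> \<subseteq> R'" "\<And>t. t \<in> ball x0 \<delta> \<Longrightarrow> (F has_real_derivative f t) (at t)"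
      using antiderivative_ball[OF R'(1,2) cont[OF R'(3)]] by blast
    then show ?thesis
      using smooth_on_real_antiderivative[OF open_ball F(3) smooth_on_subset[OF R'(3) F(2)]] F(1,2)
      by (intro exI[of _ \<delta>] exI[of _ F] conjI ballI F(3)) auto
  qed
  obtain \<delta>4 r where r: "\<delta>4 > 0" "ball x0 \<delta>4 \<subseteq> R" "\<forall>t\<in>ball x0 \<delta>4. (r has_real_derivative 1 / (s t)\<^sup>2) (at t)"
    "smooth_on (ball x0 \<delta>4) r"
    using primitive[OF R(1,2) r1] by blast
  obtain \<delta>5 B1 where B1: "\<delta>5 > 0" "ball x0 \<delta>5 \<subseteq> R"
    "\<forall>t\<in>ball x0 \<delta>5. (B1 has_real_derivative s t * (p1 t * k2 t + p2 t * k3 t)) (at t)" "smooth_on (ball x0 \<delta>5) B1"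
    using primitive[OF R(1,2) B[OF smooth_p]] by blast
  obtain \<delta>6 B2 where B2: "\<delta>6 > 0" "ball x0 \<delta>6 \<subseteq> R"
    "\<forall>t\<in>ball x0 \<delta>6. (B2 has_real_derivative s t * (q1 t * k2 t + q2 t * k3 t)) (at t)" "smooth_on (ball x0 \<delta>6) B2"
    using primitive[OF R(1,2) B[OF smooth_q]] by blast
  \<comment> \<open>\<open>b1\<close> and \<open>b2\<close> are primitives of expressions in
    \<open>B1\<close> and \<open>B2\<close>, so they are constructed inside the balls of
    these.\<close>
  have b: "smooth_on (ball x0 \<epsilon>) (\<lambda>t. B t / (s t)\<^sup>2)" if "smooth_on (ball x0 \<epsilon>) B" "ball x0 \<epsilon> \<subseteq> R" for \<epsilon> B
    by (rule smooth_on_divide[OF open_ball that(1) smooth_on_subset[OF sq that(2)]]) (use nz that(2) in auto)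
  obtain \<delta>7 b1 where b1: "\<delta>7 > 0" "ball x0 \<delta>7 \<subseteq> ball x0 \<delta>5"
    "\<forall>t\<in>ball x0 \<delta>7. (b1 has_real_derivative B1 t / (s t)\<^sup>2) (at t)" "smooth_on (ball x0 \<delta>7) b1"
    using primitive[OF open_ball _ b[OF B1(4,2)]] B1(1) by auto
  obtain \<delta>8 b2 where b2: "\<delta>8 > 0" "ball x0 \<delta>8 \<subseteq> ball x0 \<delta>6"
    "\<forall>t\<in>ball x0 \<delta>8. (b2 has_real_derivative B2 t / (s t)\<^sup>2) (at t)" "smooth_on (ball x0 \<delta>8) b2"
    using primitive[OF open_ball _ b[OF B2(4,2)]] B2(1) by auto
  define \<delta> where "\<delta> = min \<delta>4 (min \<delta>7 \<delta>8)"
  define J where "J = ball x0 \<delta>"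
  have \<delta>: "\<delta> > 0" using r(1) b1(1) b2(1) by (simp add: \<delta>_def)
  have J: "open J" "is_interval J" "x0 \<in> J" "J \<subseteq> ball x0 \<delta>4" "J \<subseteq> ball x0 \<delta>7" "J \<subseteq> ball x0 \<delta>8"
    using \<delta> by (auto simp: J_def \<delta>_def is_interval_ball_real)
  have J': "J \<subseteq> R" "J \<subseteq> T" "J \<subseteq> S" "J \<subseteq> ball x0 \<delta>5" "J \<subseteq> ball x0 \<delta>6"
    using J(4-6) r(2) b1(2) b2(2) R(3) T(3) by blast+
  have rJ: "(r has_real_derivative 1 / (s t)\<^sup>2) (at t)" "1 / (s t)\<^sup>2 > 0" if "t \<in> J" for t
    using r(3) J(4) that nz(1)[of t] J'(1) by auto
  obtain g where g: "\<And>t. t \<in> J \<Longrightarrow> g (r t) = t"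
    "\<And>t. t \<in> J \<Longrightarrow> (g has_real_derivative 1 / (1 / (s t)\<^sup>2)) (at (r t))" "open (r ` J)"
    by (rule inverse_function_real[where r = r and r' = "\<lambda>t. 1 / (s t)\<^sup>2", OF J(1,2) rJ]) blast+
  have smooth_g: "smooth_on (r ` J) g"
    by (rule smooth_on_inverse_function_real[where r' = "\<lambda>t. 1 / (s t)\<^sup>2", OF g(3) smooth_on_subset[OF r1 J'(1)] _ J(1) g(1,2)])
      (use rJ(2) in force)
  have "linearizing_data J YZ C22 C23 C32 C33 lam k2 k3 s \<sigma> p1 p2 q1 q2 B1 B2 b1 b2 r g D2 D3"
  proof
    show "smooth_on J C22" "smooth_on J C23" "smooth_on J C32" "smooth_on J C33"
      by (rule smooth_on_subset[OF _ J'(3)], rule C)+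
    show "smooth_on J s" "smooth_on J p1" "smooth_on J p2" "smooth_on J q1" "smooth_on J q2"
      by (rule smooth_s[THEN smooth_on_subset, OF J'(2)] smooth_p[THEN smooth_on_subset, OF J'(2)]
          smooth_q[THEN smooth_on_subset, OF J'(2)])+
    show "smooth_on J b1" by (rule smooth_on_subset[OF b1(4) J(5)])
    show "smooth_on J b2" by (rule smooth_on_subset[OF b2(4) J(6)])
    show "smooth_on J r" by (rule smooth_on_subset[OF r(4) J(4)])
  next
    fix t assume t: "t \<in> J"
    show "(s has_real_derivative \<sigma> t) (at t)" "(\<sigma> has_real_derivative - lam t * s t) (at t)"
      using s' t J'(2) by blast+
    show "(p1 has_real_derivative C22 t / 2 * p1 t + C32 t / 2 * p2 t) (at t)"
      "(p2 has_real_derivative C23 t / 2 * p1 t + C33 t / 2 * p2 t) (at t)"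
      using p' t J'(2) by blast+
    show "(q1 has_real_derivative C22 t / 2 * q1 t + C32 t / 2 * q2 t) (at t)"
      "(q2 has_real_derivative C23 t / 2 * q1 t + C33 t / 2 * q2 t) (at t)"
      using q' t J'(2) by blast+
    show "(b1 has_real_derivative B1 t / (s t)\<^sup>2) (at t)" "(b2 has_real_derivative B2 t / (s t)\<^sup>2) (at t)"
      using b1(3) b2(3) t J(5,6) by blast+
    show "(B1 has_real_derivative s t * (p1 t * k2 t + p2 t * k3 t)) (at t)"
      "(B2 has_real_derivative s t * (q1 t * k2 t + q2 t * k3 t)) (at t)"
      using B1(3) B2(3) t J'(4,5) by blast+
    show "s t \<noteq> 0" "p1 t * q2 t - p2 t * q1 t \<noteq> 0"
      using nz[of t] t J'(1) by (auto simp: \<Delta>_def)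
  next
    fix t y z assume "t \<in> J" "(y, z) \<in> YZ"
    then show "D2 (t, y, z) = k2 t
          + (deriv C22 t / 2 + (C22 t * C22 t + C23 t * C32 t) / 4 + lam t) * y
          + (deriv C23 t / 2 + (C22 t * C23 t + C23 t * C33 t) / 4) * z"
      "D3 (t, y, z) = k3 t
          + (deriv C32 t / 2 + (C32 t * C22 t + C33 t * C32 t) / 4) * y
          + (deriv C33 t / 2 + (C32 t * C23 t + C33 t * C33 t) / 4 + lam t) * z"
      using D2 D3 J'(3) by blast+
  qed (use J YZ rJ g smooth_g in blast)+
  then show thesis using that J(3) J'(3) by blast
qed

section \<open>The equivalence\<close>

theorem corollary2:
  fixes U :: "(real \<times> real \<times> real) set"
    and C22 C23 C32 C33 :: "real \<Rightarrow> real"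
    and D2 D3 :: "real \<times> real \<times> real \<Rightarrow> real"
  assumes "open U"
    and "smooth_on (fst ` U) C22" "smooth_on (fst ` U) C23"
        "smooth_on (fst ` U) C32" "smooth_on (fst ` U) C33"
    and "smooth_on U D2" "smooth_on U D3"
  shows "linearizable U (linear_in_first_derivatives C22 C23 C32 C33 D2 D3) \<longleftrightarrow>
    (\<forall>(x, y, z)\<in>U.
       1/2 * deriv C32 x + 1/4 * C33 x * C32 x + 1/4 * C22 x * C32 x = partial_y D3 (x, y, z) \<and>
       1/2 * deriv C23 x + 1/4 * C23 x * C33 x + 1/4 * C23 x * C22 x = partial_z D2 (x, y, z) \<and>
       1/2 * deriv C33 x - 1/2 * deriv C22 x + 1/4 * C33 x * C33 x - 1/4 * C22 x * C22 x
         = partial_z D3 (x, y, z) - partial_y D2 (x, y, z))"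
  (is "?linearizable \<longleftrightarrow> (\<forall>(x, y, z)\<in>U. ?cond x y z)")
proof
  assume lin: ?linearizable
  have "?cond x y z" if U: "(x, y, z) \<in> U" for x y z
  proof -
    obtain V \<phi> where V: "(x, y, z) \<in> V" "V \<subseteq> U" and pt: "point_transformation V \<phi>"
      and maps: "maps_system \<phi> V (linear_in_first_derivatives C22 C23 C32 C33 D2 D3) free_particle"
      using lin U unfolding linearizable_def by blast
    obtain \<psi> where \<psi>: "smooth_on (\<phi> ` V) \<psi>" "\<And>X. X \<in> V \<Longrightarrow> \<psi> (\<phi> X) = X"
      using pt unfolding point_transformation_def by blast
    have fstV: "fst ` V \<subseteq> fst ` U" using V(2) by blast
    interpret linearizing_map V \<phi> \<psi> C22 C23 C32 C33 D2 D3
      by standard (use pt maps \<psi> V(2) fstV assms smooth_on_subset in \<open>auto simp: point_transformation_def\<close>)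
    show ?thesis using conditions[OF V(1)] by blast
  qed
  then show "\<forall>(x, y, z)\<in>U. ?cond x y z" by blast
next
  assume cond: "\<forall>(x, y, z)\<in>U. ?cond x y z"
  show ?linearizable
    unfolding linearizable_def
  proof
    fix X assume "X \<in> U"
    then obtain x0 y0 z0 where X: "X = (x0, y0, z0)" "(x0, y0, z0) \<in> U" by (metis prod.collapse)
    \<comment> \<open>The affine form of \<open>D2\<close>, \<open>D3\<close> results from moving
      parallel to the axes, which calls for a box around the point.\<close>
    obtain \<delta> where \<delta>: "\<delta> > 0" "ball x0 \<delta> \<times> ball y0 \<delta> \<times> ball z0 \<delta> \<subseteq> U"
    proof -
      obtain A B where A: "open A" "open B" "x0 \<in> A" "(y0, z0) \<in> B" "A \<times> B \<subseteq> U"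
        using open_prod_elim[OF assms(1) X(2)] by (metis mem_Sigma_iff)
      obtain B1 B2 where B: "open B1" "open B2" "y0 \<in> B1" "z0 \<in> B2" "B1 \<times> B2 \<subseteq> B"
        using open_prod_elim[OF A(2,4)] by (metis mem_Sigma_iff)
      obtain d1 d2 d3 where d: "d1 > 0" "ball x0 d1 \<subseteq> A" "d2 > 0" "ball y0 d2 \<subseteq> B1" "d3 > 0" "ball z0 d3 \<subseteq> B2"
        using A(1,3) B(1-4) open_contains_ball by metis
      show thesis
      proof (rule that[of "min d1 (min d2 d3)"])
        have "ball x0 (min d1 (min d2 d3)) \<subseteq> A" "ball y0 (min d1 (min d2 d3)) \<subseteq> B1" "ball z0 (min d1 (min d2 d3)) \<subseteq> B2"
          using d by (auto simp: subset_iff)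
        then show "ball x0 (min d1 (min d2 d3)) \<times> ball y0 (min d1 (min d2 d3)) \<times> ball z0 (min d1 (min d2 d3)) \<subseteq> U"
          using A(5) B(5) by blast
      qed (use d in auto)
    qed
    let ?S = "ball x0 \<delta>" and ?YZ = "ball y0 \<delta> \<times> ball z0 \<delta>"
    define b where "b x = deriv C23 x / 2 + (C22 x * C23 x + C23 x * C33 x) / 4" for x
    define c where "c x = deriv C32 x / 2 + (C32 x * C22 x + C33 x * C32 x) / 4" for x
    define d where "d x = deriv C33 x / 2 - deriv C22 x / 2 + C33 x * C33 x / 4 - C22 x * C22 x / 4" for x
    define m where "m x = partial_y D2 (x, y0, z0)" for x
    \<comment> \<open>What remains of the y-derivative of \<open>D2\<close> after removing the upper
      left entry of \<open>C' / 2 + C\<^sup>2 / 4\<close>. By the choice of \<open>d\<close>, the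
      same \<open>lam\<close> serves the lower right entry.\<close>
    define lam where "lam x = m x - (deriv C22 x / 2 + (C22 x * C22 x + C23 x * C32 x) / 4)" for x
    \<comment> \<open>\<open>k2\<close> and \<open>k3\<close> recentre the affine expansions about
      \<open>(y0, z0)\<close> at the origin.\<close>
    define k2 where "k2 x = D2 (x, y0, z0) - m x * y0 - b x * z0" for x
    define k3 where "k3 x = D3 (x, y0, z0) - c x * y0 - (m x + d x) * z0" for x
    have S: "open ?S" "x0 \<in> ?S" using \<delta>(1) by auto
    have line: "(x, y0, z0) \<in> U" if "x \<in> ?S" for x using \<delta> that by auto
    then have "?S \<subseteq> fst ` U" by force
    note C = assms(2-5)[THEN smooth_on_subset, OF this]
    note C' = C[THEN smooth_on_deriv[OF S(1)]]
    have const: "smooth_on ?S (\<lambda>_. a)" for a :: real by (rule smooth_on_const[OF S(1)])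
    have line_smooth: "smooth_on ?S (\<lambda>x. f (x, y0, z0))" if "smooth_on U f" for f :: "real \<times> real \<times> real \<Rightarrow> real"
      by (rule smooth_on_compose[OF S(1) that]) (use line in \<open>auto intro!: smooth_intros\<close>)
    have m: "smooth_on ?S m"
    proof (rule smooth_on_cong[OF S(1) line_smooth[OF smooth_on_frechet_derivative[OF assms(6), of "(0, 1, 0)"]]])
      show "frechet_derivative D2 (at (x, y0, z0)) (0, 1, 0) = m x" if "x \<in> ?S" for x
        using partial_y_eq_frechet[OF smooth_on_differentiable[OF assms(6) line[OF that]]] by (simp add: m_def)
    qed
    have bcd: "smooth_on ?S b" "smooth_on ?S c" "smooth_on ?S d"
      unfolding b_def c_def d_def by (intro smooth_intros S(1) C C' zero_neq_numeral[symmetric])+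
    have lam: "smooth_on ?S lam"
      unfolding lam_def by (intro smooth_intros S(1) C C' m zero_neq_numeral[symmetric])
    have k: "smooth_on ?S k2" "smooth_on ?S k3"
      unfolding k2_def k3_def by (intro smooth_intros S(1) m bcd line_smooth assms(6,7))+
    have D0: "D2 (x, y, z) = D2 (x, y0, z0) + m x * (y - y0) + b x * (z - z0) \<and>
        D3 (x, y, z) = D3 (x, y0, z0) + c x * (y - y0) + (m x + d x) * (z - z0)"
      if "x \<in> ?S" "(y, z) \<in> ?YZ" for x y z
      unfolding m_def
      by (rule conjI; rule affine_in_dependent_variables[OF \<delta>(2) assms(6,7), where b = b and c = c and d = d])
        (use that cond in \<open>auto simp: b_def c_def d_def field_simps\<close>)
    have D: "D2 (x, y, z) = k2 x + (deriv C22 x / 2 + (C22 x * C22 x + C23 x * C32 x) / 4 + lam x) * y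
          + (deriv C23 x / 2 + (C22 x * C23 x + C23 x * C33 x) / 4) * z"
      "D3 (x, y, z) = k3 x + (deriv C32 x / 2 + (C32 x * C22 x + C33 x * C32 x) / 4) * y
          + (deriv C33 x / 2 + (C32 x * C23 x + C33 x * C33 x) / 4 + lam x) * z"
      if "x \<in> ?S" "(y, z) \<in> ?YZ" for x y z
    proof -
      have "m x = deriv C22 x / 2 + (C22 x * C22 x + C23 x * C32 x) / 4 + lam x"
        "b x = deriv C23 x / 2 + (C22 x * C23 x + C23 x * C33 x) / 4"
        "c x = deriv C32 x / 2 + (C32 x * C22 x + C33 x * C32 x) / 4"
        "m x + d x = deriv C33 x / 2 + (C32 x * C23 x + C33 x * C33 x) / 4 + lam x"
        by (simp_all add: lam_def b_def c_def d_def field_simps)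
      note coefficients = this[symmetric]
      show "D2 (x, y, z) = k2 x + (deriv C22 x / 2 + (C22 x * C22 x + C23 x * C32 x) / 4 + lam x) * y
          + (deriv C23 x / 2 + (C22 x * C23 x + C23 x * C33 x) / 4) * z"
        "D3 (x, y, z) = k3 x + (deriv C32 x / 2 + (C32 x * C22 x + C33 x * C32 x) / 4) * y
          + (deriv C33 x / 2 + (C32 x * C23 x + C33 x * C33 x) / 4 + lam x) * z"
        using D0[OF that] unfolding coefficients by (simp_all add: k2_def k3_def algebra_simps)
    qed
    have YZ: "open ?YZ" by (intro open_Times open_ball)
    obtain J s \<sigma> p1 p2 q1 q2 B1 B2 b1 b2 r g where J: "x0 \<in> J" "J \<subseteq> ?S"
      and data: "linearizing_data J ?YZ C22 C23 C32 C33 lam k2 k3 s \<sigma> p1 p2 q1 q2 B1 B2 b1 b2 r g D2 D3"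
      by (rule exists_linearizing_data[OF S YZ C lam k D])
    interpret linearizing_data J ?YZ C22 C23 C32 C33 lam k2 k3 s \<sigma> p1 p2 q1 q2 B1 B2 b1 b2 r g D2 D3
      by (rule data)
    have "X \<in> J \<times> ?YZ" using J(1) \<delta>(1) by (simp add: X(1))
    moreover have "J \<times> ?YZ \<subseteq> U" using J(2) \<delta>(2) by blast
    ultimately show "\<exists>V \<phi>. X \<in> V \<and> V \<subseteq> U \<and> point_transformation V \<phi> \<and>
        maps_system \<phi> V (linear_in_first_derivatives C22 C23 C32 C33 D2 D3) free_particle"
      by (intro exI[of _ "J \<times> ?YZ"] exI[of _ \<phi>] conjI point_transformation maps_system)
  qed
qed

end
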